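(* Let $K$ be a field, $S=K[x_1,\ldots,x_n]$, and let $\Gamma\subset\mathbb{N}_\infty^n$ be a multicomplex. Then the arithmetic degree of $S/I(\Gamma)$ equals the number of facets of $\Gamma$, i.e. the cardinality of $\mathcal{F}(\Gamma)$.
   Context: Let $\mathbb{N}_\infty=\mathbb{N}\cup\{\infty\}$, with $\mathbb{N}_\infty^n$ ordered componentwise. For $\Gamma\subset\mathbb{N}_\infty^n$ let $\mathcal{M}(\Gamma)$ be the set of maximal elements of $\Gamma$. For $a\in\mathbb{N}_\infty^n$ the infinite part of $a$ is $\operatorname{infpt} a=\{i: a(i)=\infty\}$. A subset $\Gamma\subset\mathbb{N}_\infty^n$ is a multicomplex if (1) $a\in\Gamma$, $b\in\mathbb{N}^n_\infty$ and $b\le a$ imply $b\in\Gamma$; (2) for each $a\in\Gamma$ there is $m\in\mathcal{M}(\Gamma)$ with $a\le m$. An element $a\in\Gamma$ is called a facet if $\operatorname{infpt} a=\operatorname{infpt} m$ for every $m\in\mathcal{M}(\Gamma)$ with $a\le m$; $\mathcal{F}(\Gamma)$ denotes the set of facets of $\Gamma$ (it is finite). $I(\Gamma)$ is the monomial ideal of $S$ spanned over $K$ by all monomials $x^a$, $a\in\mathbb{N}^n$, with $a\notin\Gamma$. The arithmetic degree of a finitely generated graded $S$-module $M$ is $\sum_{\mathfrak{p}\in\operatorname{Ass}(M)}\ell\bigl(H^0_{\mathfrak{p}}(M_{\mathfrak{p}})\bigr)\deg(S/\mathfrak{p})$, where $\ell$ is the length over $S_{\mathfrak{p}}$, $H^0_{\mathfrak{p}}(M_{\mathfrak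 p})$ is the submodule of elements of $M_{\mathfrak{p}}$ annihilated by a power of $\mathfrak{p}S_{\mathfrak p}$, and $\deg(S/\mathfrak{p})$ is the degree (multiplicity) of $S/\mathfrak{p}$. *)

theory Defs
  imports
    "HOL-Algebra.Algebra"
    "HOL-Algebra.Algebraic_Closure_Type"
    "HOL-Library.Poly_Mapping"
    "HOL-Library.Extended_Real"
begin

section \<open>Multicomplexes\<close>

text \<open>The order on \<^typ>\<open>'n \<Rightarrow> enat\<close> is the componentwise order of the library.\<close>

definition max_elems :: "('n \<Rightarrow> enat) set \<Rightarrow> ('n \<Rightarrow> enat) set" where
  "max_elems \<Gamma> = {m \<in> \<Gamma>. \<forall>b\<in>\<Gamma>. m \<le> b \<longrightarrow> b = m}"

definition infpt :: "('n \<Rightarrow> enat) \<Rightarrow> 'n set" where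
  "infpt a = {i. a i = \<infinity>}"

definition multicomplex :: "('n \<Rightarrow> enat) set \<Rightarrow> bool" where
  "multicomplex \<Gamma> \<longleftrightarrow>
     (\<forall>a\<in>\<Gamma>. \<forall>b. b \<le> a \<longrightarrow> b \<in> \<Gamma>) \<and> (\<forall>a\<in>\<Gamma>. \<exists>m\<in>max_elems \<Gamma>. a \<le> m)"

definition facets :: "('n \<Rightarrow> enat) set \<Rightarrow> ('n \<Rightarrow> enat) set" where
  "facets \<Gamma> = {a \<in> \<Gamma>. \<forall>m\<in>max_elems \<Gamma>. a \<le> m \<longrightarrow> infpt a = infpt m}"


section \<open>Modules over a commutative ring\<close>

text \<open>
  Module records extend ring records.  The \<^const>\<open>monoid.mult\<close> and
  \<^const>\<open>monoid.one\<close> fields of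
  a module play no role and are left undefined where there is no natural choice.
\<close>

definition self_module :: "('a, 'r) ring_scheme \<Rightarrow> ('a, 'a) module" where
  "self_module R =
     \<lparr>carrier = carrier R, monoid.mult = monoid.mult R, monoid.one = monoid.one R,
      ring.zero = ring.zero R, ring.add = ring.add R, module.smult = monoid.mult R\<rparr>"

definition quot_module :: "('a, 'r) ring_scheme \<Rightarrow> 'a set \<Rightarrow> ('a, 'a set) module" where
  "quot_module R I =
     \<lparr>carrier = carrier (R Quot I), monoid.mult = monoid.mult (R Quot I),
      monoid.one = monoid.one (R Quot I),
      ring.zero = ring.zero (R Quot I), ring.add = ring.add (R Quot I),
      module.smult = (\<lambda>r Z. (I +>\<^bsub>R\<^esub> r) \<otimes>\<^bsub>R Quot I\<^esub> Z)\<rparr>"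

definition mod_length :: "('a, 'r) ring_scheme \<Rightarrow> ('a, 'b, 'm) module_scheme \<Rightarrow> enat" where
  "mod_length R M =
     (SUP k\<in>{k. \<exists>N. (\<forall>i\<le>k. submodule (N i) R M) \<and> (\<forall>i<k. N i \<subset> N (Suc i))}. enat k)"

definition ass_primes :: "('a, 'r) ring_scheme \<Rightarrow> ('a, 'b, 'm) module_scheme \<Rightarrow> 'a set set" where
  "ass_primes R M =
     {p. primeideal p R \<and>
         (\<exists>m\<in>carrier M. p = {r \<in> carrier R. r \<odot>\<^bsub>M\<^esub> m = \<zero>\<^bsub>M\<^esub>})}"

text \<open>\<open>H\<^sup>0\<^sub>J(M)\<close>: the elements annihilated by a power of the ideal \<open>J\<close>; powers
  are taken in the multiplicative monoid of ideals.\<close>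

definition H0 ::
    "('a, 'r) ring_scheme \<Rightarrow> 'a set \<Rightarrow> ('a, 'b, 'm) module_scheme \<Rightarrow> 'b set" where
  "H0 R J M =
     {x \<in> carrier M. \<exists>k::nat. \<forall>a \<in> J [^]\<^bsub>ideals_set R\<^esub> k. a \<odot>\<^bsub>M\<^esub> x = \<zero>\<^bsub>M\<^esub>}"


subsection \<open>Localization at a prime ideal\<close>

text \<open>\<open>loc_frac R M p m s\<close> is the fraction \<open>m / s\<close> in \<open>M\<^sub>p\<close>; \<open>loc_ring R p\<close> is \<open>R\<^sub>p\<close>,
  the localization of \<open>R\<close> as a module over itself, and \<open>loc_ideal R p\<close> is \<open>p R\<^sub>p\<close>.
  \<open>local_mult R M p\<close> is the length of \<open>H\<^sup>0\<^sub>p(M\<^sub>p)\<close> over \<open>R\<^sub>p\<close>.\<close>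

definition loc_rel :: "('a, 'r) ring_scheme \<Rightarrow> ('a, 'b, 'm) module_scheme \<Rightarrow> 'a set
    \<Rightarrow> (('b \<times> 'a) \<times> ('b \<times> 'a)) set" where
  "loc_rel R M p =
     {((m, s), (m', s')).
        m \<in> carrier M \<and> m' \<in> carrier M \<and> s \<in> carrier R - p \<and> s' \<in> carrier R - p \<and>
        (\<exists>u \<in> carrier R - p. u \<odot>\<^bsub>M\<^esub> (s' \<odot>\<^bsub>M\<^esub> m) = u \<odot>\<^bsub>M\<^esub> (s \<odot>\<^bsub>M\<^esub> m'))}"

definition loc_frac :: "('a, 'r) ring_scheme \<Rightarrow> ('a, 'b, 'm) module_scheme \<Rightarrow> 'a set
    \<Rightarrow> 'b \<Rightarrow> 'a \<Rightarrow> ('b \<times> 'a) set" where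
  "loc_frac R M p m s = loc_rel R M p `` {(m, s)}"

definition loc_carrier :: "('a, 'r) ring_scheme \<Rightarrow> ('a, 'b, 'm) module_scheme \<Rightarrow> 'a set
    \<Rightarrow> ('b \<times> 'a) set set" where
  "loc_carrier R M p = (carrier M \<times> (carrier R - p)) // loc_rel R M p"

definition loc_add :: "('a, 'r) ring_scheme \<Rightarrow> ('a, 'b, 'm) module_scheme \<Rightarrow> 'a set
    \<Rightarrow> ('b \<times> 'a) set \<Rightarrow> ('b \<times> 'a) set \<Rightarrow> ('b \<times> 'a) set" where
  "loc_add R M p Z Y =
     (\<Union>(m, s)\<in>Z. \<Union>(m', s')\<in>Y.
        loc_frac R M p (s' \<odot>\<^bsub>M\<^esub> m \<oplus>\<^bsub>M\<^esub> s \<odot>\<^bsub>M\<^esub> m') (s \<otimes>\<^bsub>R\<^esub> s'))"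

definition loc_smult :: "('a, 'r) ring_scheme \<Rightarrow> ('a, 'b, 'm) module_scheme \<Rightarrow> 'a set
    \<Rightarrow> ('a \<times> 'a) set \<Rightarrow> ('b \<times> 'a) set \<Rightarrow> ('b \<times> 'a) set" where
  "loc_smult R M p A Z =
     (\<Union>(r, t)\<in>A. \<Union>(m, s)\<in>Z. loc_frac R M p (r \<odot>\<^bsub>M\<^esub> m) (t \<otimes>\<^bsub>R\<^esub> s))"

definition loc_ring :: "('a, 'r) ring_scheme \<Rightarrow> 'a set \<Rightarrow> ('a \<times> 'a) set ring" where
  "loc_ring R p =
     \<lparr>carrier = loc_carrier R (self_module R) p,
      monoid.mult = loc_smult R (self_module R) p,
      monoid.one = loc_frac R (self_module R) p \<one>\<^bsub>R\<^esub> \<one>\<^bsub>R\<^esub>,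
      ring.zero = loc_frac R (self_module R) p \<zero>\<^bsub>R\<^esub> \<one>\<^bsub>R\<^esub>,
      ring.add = loc_add R (self_module R) p\<rparr>"

definition loc_module :: "('a, 'r) ring_scheme \<Rightarrow> ('a, 'b, 'm) module_scheme \<Rightarrow> 'a set
    \<Rightarrow> (('a \<times> 'a) set, ('b \<times> 'a) set) module" where
  "loc_module R M p =
     \<lparr>carrier = loc_carrier R M p,
      monoid.mult = undefined,
      monoid.one = undefined,
      ring.zero = loc_frac R M p \<zero>\<^bsub>M\<^esub> \<one>\<^bsub>R\<^esub>,
      ring.add = loc_add R M p,
      module.smult = loc_smult R M p\<rparr>"

definition loc_ideal :: "('a, 'r) ring_scheme \<Rightarrow> 'a set \<Rightarrow> ('a \<times> 'a) set set" where
  "loc_ideal R p = {loc_frac R (self_module R) p a s | a s. a \<in> p \<and> s \<in> carrier R - p}"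

definition local_mult :: "('a, 'r) ring_scheme \<Rightarrow> ('a, 'b, 'm) module_scheme \<Rightarrow> 'a set \<Rightarrow> enat"
  where
  "local_mult R M p =
     mod_length (loc_ring R p)
       ((loc_module R M p)\<lparr>carrier := H0 (loc_ring R p) (loc_ideal R p) (loc_module R M p)\<rparr>)"


section \<open>Polynomials, degree and arithmetic degree\<close>

text \<open>Variables are indexed by the finite type \<^typ>\<open>'n\<close>; an exponent vector is a
  \<^typ>\<open>'n \<Rightarrow>\<^sub>0 nat\<close>, and \<open>x\<^sup>a\<close> is \<open>Poly_Mapping.single a 1\<close>.\<close>

type_synonym ('n, 'k) mpoly = "('n \<Rightarrow>\<^sub>0 nat) \<Rightarrow>\<^sub>0 'k"

abbreviation mpoly_ring :: "('n::finite, 'k::field) mpoly ring" where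
  "mpoly_ring \<equiv> ring_of_type_algebra"

definition hom_part :: "nat \<Rightarrow> ('n::finite, 'k::field) mpoly set" where
  "hom_part k = {f. \<forall>a\<in>Poly_Mapping.keys f. (\<Sum>i\<in>UNIV. Poly_Mapping.lookup a i) = k}"

text \<open>For a proper homogeneous ideal \<open>J\<close>, the dimension over \<open>K\<close> (embedded in \<open>S/J\<close> as
  the subfield of constants) of the degree \<open>k\<close> component of \<open>S/J\<close>.\<close>

definition hilbert_fun :: "('n::finite, 'k::field) mpoly set \<Rightarrow> nat \<Rightarrow> nat" where
  "hilbert_fun J k =
     ring.dim (mpoly_ring Quot J)
       (range (\<lambda>c. J +>\<^bsub>mpoly_ring\<^esub> Poly_Mapping.single 0 c))
       ((\<lambda>f. J +>\<^bsub>mpoly_ring\<^esub> f) ` hom_part k)"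

definition hilbert_poly :: "('n::finite, 'k::field) mpoly set \<Rightarrow> real Polynomial.poly" where
  "hilbert_poly J =
     (THE P. \<exists>N. \<forall>k\<ge>N. Polynomial.poly P (real k) = real (hilbert_fun J k))"

text \<open>The multiplicity of \<open>S/J\<close>: if the Hilbert polynomial has degree \<open>d - 1\<close> it is
  \<open>(d - 1)!\<close> times the leading coefficient; if \<open>S/J\<close> has dimension 0, so that the Hilbert
  polynomial vanishes, it is the length.\<close>

definition quot_degree :: "('n::finite, 'k::field) mpoly set \<Rightarrow> ereal" where
  "quot_degree J =
     (let P = hilbert_poly J in
      if P = 0 then ereal_of_enat (mod_length mpoly_ring (quot_module mpoly_ring J))
      else ereal (fact (Polynomial.degree P) * Polynomial.lead_coeff P))"

definition arith_degree ::
    "(('n::finite, 'k::field) mpoly, 'b, 'm) module_scheme \<Rightarrow> ereal" where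
  "arith_degree M =
     (\<Sum>p\<in>ass_primes mpoly_ring M. ereal_of_enat (local_mult mpoly_ring M p) * quot_degree p)"

text \<open>The first argument of \<^const>\<open>Modules.module.span\<close> is the action of \<open>K\<close> on \<open>S\<close>.\<close>

definition mc_ideal :: "('n::finite \<Rightarrow> enat) set \<Rightarrow> ('n, 'k::field) mpoly set" where
  "mc_ideal \<Gamma> =
     Modules.module.span (\<lambda>c f. Poly_Mapping.single 0 c * f)
       {Poly_Mapping.single a 1 | a. (\<lambda>i. enat (Poly_Mapping.lookup a i)) \<notin> \<Gamma>}"

end

theory Submission
  imports Defs
begin

text \<open>
  Write \<open>S\<close> for the polynomial ring, \<open>I\<close> for the ideal of the multicomplex \<open>\<Gamma>\<close> and \<open>P\<^sub>F\<close> for the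
  prime ideal generated by the variables \<open>x\<^sub>i\<close> with \<open>i \<notin> F\<close>.  The facets with infinite part \<open>F\<close>
  are counted by the contribution of \<open>P\<^sub>F\<close> to the arithmetic degree of \<open>S/I\<close>, and no other
  primes contribute.

  Localizing at \<open>P\<^sub>F\<close> makes the variables in \<open>F\<close> invertible.  A monomial \<open>x\<^sup>b\<close> therefore
  vanishes in \<open>(S/I)\<close> localized at \<open>P\<^sub>F\<close> if and only if some \<open>x\<^sup>b x\<^sup>c\<close> with \<open>c\<close> supported
  in \<open>F\<close> lies in \<open>I\<close>; since \<open>\<Gamma>\<close> contains the limits of its increasing sequences, this says that
  the vector obtained from \<open>b\<close> by setting the coordinates in \<open>F\<close> to \<open>\<infinity>\<close> is not in \<open>\<Gamma>\<close>
  (\<open>infty_on_limit\<close>).  If it is in \<open>\<Gamma>\<close>, then \<open>x\<^sup>b\<close> is killed by a power of \<open>P\<^sub>F\<close> if and only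
  if no further coordinate can be raised to \<open>\<infinity>\<close> inside \<open>\<Gamma>\<close>, which is the condition for a facet.
  So the facets with infinite part \<open>F\<close> generate \<open>H\<^sup>0\<close>.  Order them by decreasing degree:
  multiplication by a variable outside \<open>F\<close> raises the degree, so it sends a facet monomial to
  zero or to an earlier one.  Adding the facets one by one thus gives a composition
  series, and the length is the number of facets with infinite part \<open>F\<close>
  (\<open>local_mult_eq_card_facets\<close>).

  A vector of natural numbers lies in \<open>\<Gamma>\<close> if and only if it lies below one of the maximal elements \<open>m\<close> of
  \<open>\<Gamma>\<close>, of which there are finitely many by Dickson's lemma (\<open>finite_antichain\<close>).  Hence \<open>I\<close> is the
  intersection of the ideals generated by the \<open>x\<^sub>i\<^sup>k\<close> with \<open>k = m i + 1\<close>, \<open>m i < \<infinity>\<close>, and these are primary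
  to \<open>P\<^sub>F\<close> for \<open>F\<close> the infinite part of \<open>m\<close>.  So the associated primes of
  \<open>S/I\<close> are the \<open>P\<^sub>F\<close> with \<open>F\<close> the infinite part of a maximal element, equivalently of a facet
  (\<open>ass_primes_mc_ideal\<close>).  Finally \<open>S/P\<^sub>F\<close> is a polynomial ring and has degree 1
  (\<open>quot_degree_coord_prime\<close>), so the arithmetic degree is the sum over \<open>F\<close> of the numbers of facets with
  infinite part \<open>F\<close>.

  One cancellation property carries the algebra (\<open>mono_span_cancel\<close>): if a set of exponents is
  closed under increasing coordinates outside \<open>F\<close> and under changing coordinates in \<open>F\<close>
  arbitrarily, then elements outside \<open>P\<^sub>F\<close> are not zero divisors modulo the span of the
  corresponding monomials.  It yields that \<open>P\<^sub>F\<close> is prime, that the components of \<open>I\<close> are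
  primary, and that the members of the composition series can be compared before localizing.
\<close>

section \<open>Maximal elements and facets\<close>

text \<open>An antitone sequence in a well-order becomes constant once it reaches its least value, so
  the monotone subsequence that exists in any linear order can be chosen increasing.\<close>

lemma wellorder_mono_subseq:
  fixes s :: "nat \<Rightarrow> 'b::wellorder"
  obtains r :: "nat \<Rightarrow> nat" where "strict_mono r" "mono (s \<circ> r)"
proof -
  obtain r :: "nat \<Rightarrow> nat" where r: "strict_mono r" "monoseq (\<lambda>n. s (r n))"
    using seq_monosub[of s] by blast
  show thesis
  proof (cases "mono (\<lambda>n. s (r n))")
    case True
    then show thesis using r(1) that[of r] by (simp add: o_def)
  next
    case False
    then have dec: "s (r n) \<le> s (r m)" if "m \<le> n" for m n
      using r(2) that unfolding monoseq_def mono_def by blast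
    define v where "v = (LEAST v. v \<in> range (\<lambda>n. s (r n)))"
    have "v \<in> range (\<lambda>n. s (r n))"
      unfolding v_def by (rule LeastI) (rule rangeI)
    then obtain N where N: "v = s (r N)" by blast
    have least: "v \<le> s (r n)" for n
      unfolding v_def by (rule Least_le) (rule rangeI)
    have "s (r (n + N)) = v" for n
      using least[of "n + N"] dec[of N "n + N"] N by simp
    then have "mono (s \<circ> (\<lambda>n. r (n + N)))"
      by (simp add: mono_def)
    moreover have "strict_mono (\<lambda>n. r (n + N))"
      using r(1) by (simp add: strict_mono_def)
    ultimately show thesis by (rule that[rotated])
  qed
qed

lemma componentwise_mono_subseq:
  fixes s :: "nat \<Rightarrow> 'n \<Rightarrow> 'b::wellorder"
  assumes "finite A"
  shows "\<exists>r :: nat \<Rightarrow> nat. strict_mono r \<and> (\<forall>i\<in>A. mono (\<lambda>n. s (r n) i))"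
  using assms
proof induction
  case empty
  have "strict_mono (id :: nat \<Rightarrow> nat)" by (simp add: strict_mono_def)
  then show ?case by blast
next
  case (insert j A)
  then obtain r :: "nat \<Rightarrow> nat" where r: "strict_mono r" "\<And>i. i \<in> A \<Longrightarrow> mono (\<lambda>n. s (r n) i)" by blast
  obtain q :: "nat \<Rightarrow> nat" where q: "strict_mono q" "mono ((\<lambda>n. s (r n) j) \<circ> q)"
    using wellorder_mono_subseq[of "\<lambda>n. s (r n) j"] by blast
  have "mono (\<lambda>n. s ((r \<circ> q) n) i)" if "i \<in> insert j A" for i
    using that r(2) q strict_mono_mono[OF q(1)] by (auto simp: mono_def)
  with strict_mono_o[OF r(1) q(1)] show ?case by blast
qed

text \<open>Dickson's lemma: an infinite antichain would contain a sequence of distinct elements, and a subsequence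
  monotone in every coordinate contradicts incomparability.\<close>

lemma finite_antichain:
  fixes A :: "('n::finite \<Rightarrow> 'b::wellorder) set"
  assumes "\<And>a b. a \<in> A \<Longrightarrow> b \<in> A \<Longrightarrow> a \<le> b \<Longrightarrow> a = b"
  shows "finite A"
proof (rule ccontr)
  assume "infinite A"
  then obtain s :: "nat \<Rightarrow> _" where s: "inj s" "range s \<subseteq> A"
    using infinite_countable_subset by blast
  obtain r :: "nat \<Rightarrow> nat" where r: "strict_mono r" "\<And>i. mono (\<lambda>n. s (r n) i)"
    using componentwise_mono_subseq[OF finite_UNIV, of s] by auto
  have "s (r 0) \<le> s (r 1)"
    using r(2) by (auto simp: le_fun_def mono_def)
  then have "s (r 0) = s (r 1)" using s(2) assms by blast
  then have "r 0 = r 1" using s(1) by (auto dest: injD)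
  moreover have "r 0 < r 1"
    using r(1) by (rule strict_monoD) simp
  ultimately show False by linarith
qed

lemma multicomplex_downward:
  assumes "multicomplex \<Gamma>" "a \<in> \<Gamma>" "b \<le> a"
  shows "b \<in> \<Gamma>"
  using assms(1)[unfolded multicomplex_def, THEN conjunct1, rule_format, OF assms(2,3)] .

lemma multicomplex_below_max:
  assumes "multicomplex \<Gamma>" "a \<in> \<Gamma>"
  obtains m where "m \<in> max_elems \<Gamma>" "a \<le> m"
  using assms(1)[unfolded multicomplex_def, THEN conjunct2, rule_format, OF assms(2)] that by blast

lemma multicomplex_mem_iff:
  assumes mc: "multicomplex \<Gamma>"
  shows "a \<in> \<Gamma> \<longleftrightarrow> (\<exists>m\<in>max_elems \<Gamma>. a \<le> m)"
proof
  assume "a \<in> \<Gamma>"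
  then show "\<exists>m\<in>max_elems \<Gamma>. a \<le> m"
    using multicomplex_below_max[OF mc] by metis
next
  assume "\<exists>m\<in>max_elems \<Gamma>. a \<le> m"
  then obtain m where "m \<in> \<Gamma>" "a \<le> m" by (auto simp: max_elems_def)
  then show "a \<in> \<Gamma>" by (rule multicomplex_downward[OF mc])
qed

lemma finite_max_elems: "finite (max_elems (\<Gamma> :: ('n::finite \<Rightarrow> enat) set))"
  by (rule finite_antichain) (unfold max_elems_def, blast)

lemma infpt_mono:
  assumes "a \<le> b"
  shows "infpt a \<subseteq> infpt b"
proof
  fix i assume "i \<in> infpt a"
  then have "\<infinity> \<le> b i"
    using le_funD[OF assms, of i] by (simp add: infpt_def)
  then show "i \<in> infpt b" by (simp add: infpt_def)
qed

lemma max_elems_mem: "m \<in> max_elems \<Gamma> \<Longrightarrow> m \<in> \<Gamma>"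
  unfolding max_elems_def by blast

lemma max_elems_maximal: "m \<in> max_elems \<Gamma> \<Longrightarrow> b \<in> \<Gamma> \<Longrightarrow> m \<le> b \<Longrightarrow> b = m"
  unfolding max_elems_def by blast

lemma facets_mem: "a \<in> facets \<Gamma> \<Longrightarrow> a \<in> \<Gamma>"
  unfolding facets_def by blast

lemma facets_infpt: "a \<in> facets \<Gamma> \<Longrightarrow> m \<in> max_elems \<Gamma> \<Longrightarrow> a \<le> m \<Longrightarrow> infpt a = infpt m"
  unfolding facets_def by blast

text \<open>Maximal elements may be replaced by arbitrary elements of the multicomplex, because infinite
  parts grow along the order and every element lies below a maximal one.\<close>

lemma facet_iff:
  assumes "multicomplex \<Gamma>"
  shows "a \<in> facets \<Gamma> \<longleftrightarrow> a \<in> \<Gamma> \<and> (\<forall>b\<in>\<Gamma>. a \<le> b \<longrightarrow> infpt b = infpt a)"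
proof (intro iffI conjI ballI impI)
  fix b assume a: "a \<in> facets \<Gamma>" and b: "b \<in> \<Gamma>" "a \<le> b"
  obtain m where m: "m \<in> max_elems \<Gamma>" "b \<le> m"
    using multicomplex_below_max[OF assms b(1)] .
  then have "infpt a = infpt m"
    using facets_infpt[OF a] order_trans[OF b(2)] by blast
  then show "infpt b = infpt a"
    using infpt_mono[OF b(2)] infpt_mono[OF m(2)] by blast
next
  assume "a \<in> \<Gamma> \<and> (\<forall>b\<in>\<Gamma>. a \<le> b \<longrightarrow> infpt b = infpt a)"
  then show "a \<in> facets \<Gamma>"
    unfolding facets_def using max_elems_mem by blast
qed (rule facets_mem)

lemma max_elems_subset_facets: "max_elems \<Gamma> \<subseteq> facets \<Gamma>"
  unfolding max_elems_def facets_def by blast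

text \<open>Maximal elements are facets, and a facet has the infinite part of any maximal element above it.\<close>

lemma infpt_facets:
  assumes "multicomplex \<Gamma>"
  shows "infpt ` facets \<Gamma> = infpt ` max_elems \<Gamma>"
proof
  show "infpt ` facets \<Gamma> \<subseteq> infpt ` max_elems \<Gamma>"
  proof
    fix F assume "F \<in> infpt ` facets \<Gamma>"
    then obtain a where a: "a \<in> facets \<Gamma>" "F = infpt a" by blast
    then obtain m where "m \<in> max_elems \<Gamma>" "a \<le> m"
      using multicomplex_below_max[OF assms] facets_mem by metis
    then show "F \<in> infpt ` max_elems \<Gamma>" using a facets_infpt by blast
  qed
qed (use max_elems_subset_facets in blast)

lemma finite_same_infpt_below:
  fixes m :: "'n::finite \<Rightarrow> enat"
  shows "finite {a. a \<le> m \<and> infpt a = infpt m}"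
proof (rule finite_subset)
  show "{a. a \<le> m \<and> infpt a = infpt m}
      \<subseteq> Pi\<^sub>E UNIV (\<lambda>i. if m i = \<infinity> then {\<infinity>} else {..m i})"
    by (auto simp: infpt_def le_fun_def)
  show "finite (Pi\<^sub>E UNIV (\<lambda>i. if m i = \<infinity> then {\<infinity>} else {..m i}))"
  proof (intro finite_PiE)
    show "finite (if m i = \<infinity> then {\<infinity>} else {..m i})" for i
    proof (cases "m i")
      case (enat k)
      have "finite {..enat k}" by (rule finite_enat_bounded[of _ k]) simp
      with enat show ?thesis by simp
    qed simp
  qed simp
qed

text \<open>Each facet lies below a maximal element with the same infinite part, and below a fixed
  vector there are only finitely many vectors with the same infinite part.\<close>

lemma finite_facets:
  fixes \<Gamma> :: "('n::finite \<Rightarrow> enat) set"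
  assumes "multicomplex \<Gamma>"
  shows "finite (facets \<Gamma>)"
proof (rule finite_subset)
  show "facets \<Gamma> \<subseteq> (\<Union>m\<in>max_elems \<Gamma>. {a. a \<le> m \<and> infpt a = infpt m})"
  proof
    fix a assume a: "a \<in> facets \<Gamma>"
    then obtain m where m: "m \<in> max_elems \<Gamma>" "a \<le> m"
      using multicomplex_below_max[OF assms] facets_mem by metis
    have "a \<in> {a. a \<le> m \<and> infpt a = infpt m}"
      using m(2) facets_infpt[OF a m] by simp
    then show "a \<in> (\<Union>m\<in>max_elems \<Gamma>. {a. a \<le> m \<and> infpt a = infpt m})"
      using m(1) by blast
  qed
  show "finite (\<Union>m\<in>max_elems \<Gamma>. {a. a \<le> m \<and> infpt a = infpt m})"
    using finite_max_elems finite_same_infpt_below by (rule finite_UN_I)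
qed

text \<open>The monomial \<open>x\<^sup>b\<close> up to powers of the variables in \<open>F\<close>, recorded as a point of the
  extended lattice.  For empty \<open>F\<close> it is the exponent \<open>b\<close> itself.\<close>

definition infty_on :: "'n set \<Rightarrow> ('n \<Rightarrow>\<^sub>0 nat) \<Rightarrow> 'n \<Rightarrow> enat" where
  "infty_on F b = (\<lambda>i. if i \<in> F then \<infinity> else enat (Poly_Mapping.lookup b i))"

lemma infpt_infty_on [simp]: "infpt (infty_on F b) = F"
  unfolding infpt_def infty_on_def by simp

lemma infty_on_empty: "infty_on {} b = (\<lambda>i. enat (Poly_Mapping.lookup b i))"
  by (simp add: infty_on_def)

lemma infty_on_le_iff:
  "infty_on F a \<le> infty_on F b \<longleftrightarrow> (\<forall>i. i \<notin> F \<longrightarrow> Poly_Mapping.lookup a i \<le> Poly_Mapping.lookup b i)"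
proof -
  have "infty_on F a i \<le> infty_on F b i
      \<longleftrightarrow> (i \<notin> F \<longrightarrow> Poly_Mapping.lookup a i \<le> Poly_Mapping.lookup b i)" for i
    by (simp add: infty_on_def)
  then show ?thesis by (simp only: le_fun_def)
qed

lemma infty_on_eq_iff:
  "infty_on F a = infty_on F b \<longleftrightarrow> (\<forall>i. i \<notin> F \<longrightarrow> Poly_Mapping.lookup a i = Poly_Mapping.lookup b i)"
proof -
  have "infty_on F a i = infty_on F b i
      \<longleftrightarrow> (i \<notin> F \<longrightarrow> Poly_Mapping.lookup a i = Poly_Mapping.lookup b i)" for i
    by (simp add: infty_on_def)
  then show ?thesis by (simp only: fun_eq_iff)
qed

lemma infty_on_le_iff_of_infpt:
  assumes "infpt m = F"
  shows "infty_on F b \<le> m \<longleftrightarrow> infty_on {} b \<le> m"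
proof -
  have "infty_on F b i \<le> m i \<longleftrightarrow> infty_on {} b i \<le> m i" for i
  proof (cases "i \<in> F")
    case True
    then have "m i = \<infinity>" using assms unfolding infpt_def by blast
    then show ?thesis by simp
  qed (simp add: infty_on_def)
  then show ?thesis by (simp only: le_fun_def)
qed

definition exponent :: "('n::finite \<Rightarrow> nat) \<Rightarrow> 'n \<Rightarrow>\<^sub>0 nat" where
  "exponent f = Poly_Mapping.Abs_poly_mapping f"

lemma lookup_exponent [simp]: "Poly_Mapping.lookup (exponent f) i = f i"
  by (simp add: exponent_def)

lemma infty_on_cases:
  fixes a :: "'n::finite \<Rightarrow> enat"
  obtains b where "a = infty_on (infpt a) b"
proof
  show "a = infty_on (infpt a) (exponent (\<lambda>i. the_enat (a i)))"
    by (rule ext) (auto simp add: infty_on_def infpt_def)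
qed

text \<open>The exponent of the \<open>N\<close>-th power of the product of the variables in \<open>F\<close>.\<close>

definition block :: "'n::finite set \<Rightarrow> nat \<Rightarrow> 'n \<Rightarrow>\<^sub>0 nat" where
  "block F N = exponent (\<lambda>i. if i \<in> F then N else 0)"

lemma lookup_block: "Poly_Mapping.lookup (block F N) i = (if i \<in> F then N else 0)"
  by (simp add: block_def)

text \<open>Multicomplexes are closed under limits of increasing sequences.  For each of the finitely many maximal
  elements \<open>m\<close> there is a coordinate witnessing that the limit vector is not below \<open>m\<close>; if this
  coordinate lies in \<open>F\<close>, then \<open>m\<close> is finite there and a large \<open>N\<close> exceeds it.\<close>

lemma infty_on_limit:
  fixes \<Gamma> :: "('n::finite \<Rightarrow> enat) set"
  assumes mc: "multicomplex \<Gamma>" and "infty_on F b \<notin> \<Gamma>"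
  obtains N0 where "\<And>N. N0 \<le> N \<Longrightarrow> infty_on {} (block F N + b) \<notin> \<Gamma>"
proof -
  have bound: "\<exists>k. \<forall>N\<ge>k. \<not> infty_on {} (block F N + b) \<le> m" if m: "m \<in> max_elems \<Gamma>" for m
  proof -
    have "\<not> infty_on F b \<le> m"
      using assms(2) m multicomplex_mem_iff[OF mc] by blast
    then obtain i where i: "\<not> infty_on F b i \<le> m i" by (auto simp: le_fun_def)
    show ?thesis
    proof (cases "i \<in> F")
      case True
      then obtain k where k: "m i = enat k"
        using i by (auto simp: infty_on_def)
      have "\<not> infty_on {} (block F N + b) i \<le> m i" if "Suc k \<le> N" for N
        using that True k by (simp add: infty_on_def lookup_add lookup_block)
      then show ?thesis unfolding le_fun_def by blast
    next
      case False
      then have "\<not> infty_on {} (block F N + b) i \<le> m i" for N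
        using i by (simp add: infty_on_def lookup_add lookup_block)
      then show ?thesis unfolding le_fun_def by blast
    qed
  qed
  then obtain k where k: "\<And>m N. m \<in> max_elems \<Gamma> \<Longrightarrow> k m \<le> N \<Longrightarrow> \<not> infty_on {} (block F N + b) \<le> m"
    by metis
  show thesis
  proof
    fix N assume N: "Max (insert 0 (k ` max_elems \<Gamma>)) \<le> N"
    have "k m \<le> N" if "m \<in> max_elems \<Gamma>" for m
      by (rule order_trans[OF Max_ge N]) (use that finite_max_elems in auto)
    then show "infty_on {} (block F N + b) \<notin> \<Gamma>"
      using k multicomplex_mem_iff[OF mc] by blast
  qed
qed


section \<open>Length\<close>

lemma submodule_mem_carrier:
  "submodule N R M \<Longrightarrow> x \<in> N \<Longrightarrow> x \<in> carrier M"
  using subgroup.subset[of N "add_monoid M"] submodule.axioms(1)[of N R M] by auto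

lemma submodule_zero: "submodule N R M \<Longrightarrow> \<zero>\<^bsub>M\<^esub> \<in> N"
  using subgroup.one_closed[of N "add_monoid M"] submodule.axioms(1)[of N R M] by simp

lemma submodule_add:
  "submodule N R M \<Longrightarrow> x \<in> N \<Longrightarrow> y \<in> N \<Longrightarrow> x \<oplus>\<^bsub>M\<^esub> y \<in> N"
  using subgroup.m_closed[of N "add_monoid M" x y] submodule.axioms(1)[of N R M] by simp

lemma submodule_diff:
  assumes "submodule N R M" "x \<in> N" "y \<in> N"
  shows "x \<ominus>\<^bsub>M\<^esub> y \<in> N"
proof -
  have "\<ominus>\<^bsub>M\<^esub> y \<in> N"
    using subgroup.m_inv_closed[OF submodule.axioms(1)[OF assms(1)] assms(3)] by (simp add: a_inv_def)
  then show ?thesis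
    using submodule_add[OF assms(1,2)] by (simp add: a_minus_def)
qed

text \<open>Computes a length without the Jordan-Hoelder theorem.  To a submodule \<open>L\<close> attach the set of steps \<open>i\<close> at
  which \<open>L \<inter> N i\<close> grows.  This set is monotone in \<open>L\<close>, and since each step of the filtration is
  simple, nested submodules with the same set of steps are equal.  So a strict chain of
  submodules is no longer than the number of steps.\<close>

lemma mod_length_filtration:
  fixes R (structure) and M (structure) and N :: "nat \<Rightarrow> 'b set"
  assumes M: "abelian_group M"
    and sub: "\<And>i. i \<le> n \<Longrightarrow> submodule (N i) R M"
    and bot: "N 0 = {\<zero>\<^bsub>M\<^esub>}" and top: "N n = carrier M"
    and strict: "\<And>i. i < n \<Longrightarrow> N i \<subset> N (Suc i)"
    and simple: "\<And>i x y. i < n \<Longrightarrow> x \<in> N (Suc i) \<Longrightarrow> y \<in> N (Suc i) - N i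
      \<Longrightarrow> \<exists>r\<in>carrier R. \<exists>z\<in>N i. x = z \<oplus>\<^bsub>M\<^esub> r \<odot>\<^bsub>M\<^esub> y"
  shows "mod_length R M = enat n"
proof -
  interpret abelian_group M by fact
  \<comment> \<open>The steps at which \<open>L\<close> acquires new elements.\<close>
  define jumps where "jumps L = {i. i < n \<and> \<not> L \<inter> N (Suc i) \<subseteq> N i}" for L
  have jumps_mono: "jumps L \<subseteq> jumps L'" if "L \<subseteq> L'" for L L'
    using that unfolding jumps_def by blast
  have jumps_inj: "L = L'"
    if L: "submodule L R M" "submodule L' R M" "L \<subseteq> L'" and eq: "jumps L = jumps L'" for L L'
  proof -
    have "L' \<inter> N i \<subseteq> L" if "i \<le> n" for i
      using that
    proof (induction i)
      case 0
      then show ?case using bot submodule_zero[OF L(1)] by auto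
    next
      case (Suc i)
      show ?case
      proof
        fix x assume x: "x \<in> L' \<inter> N (Suc i)"
        show "x \<in> L"
        proof (cases "x \<in> N i")
          case True
          then show ?thesis using Suc x by auto
        next
          case False
          then have "i \<in> jumps L'"
            using x Suc.prems unfolding jumps_def by auto
          then have "i \<in> jumps L"
            using eq by simp
          then obtain y where y: "y \<in> L" "y \<in> N (Suc i) - N i"
            unfolding jumps_def by blast
          obtain r z where rz: "r \<in> carrier R" "z \<in> N i" "x = z \<oplus>\<^bsub>M\<^esub> r \<odot>\<^bsub>M\<^esub> y"
            using simple[of i x y] x y Suc.prems by auto
          have ry: "r \<odot>\<^bsub>M\<^esub> y \<in> L"
            using submodule.smult_closed[OF L(1) rz(1) y(1)] .
          have car: "z \<in> carrier M" "r \<odot>\<^bsub>M\<^esub> y \<in> carrier M"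
            using submodule_mem_carrier[OF sub rz(2)] submodule_mem_carrier[OF L(1) ry] Suc.prems by auto
          have "z = x \<ominus>\<^bsub>M\<^esub> r \<odot>\<^bsub>M\<^esub> y"
            unfolding rz(3) using car by (simp add: a_minus_def a_assoc r_neg)
          also have "\<dots> \<in> L'"
            using submodule_diff[OF L(2), of x "r \<odot>\<^bsub>M\<^esub> y"] x ry L(3) by auto
          finally have "z \<in> L" using Suc rz(2) by auto
          then show ?thesis
            unfolding rz(3) using submodule_add[OF L(1)] ry by blast
        qed
      qed
    qed
    from this[of n] have "L' \<subseteq> L"
      using top submodule_mem_carrier[OF L(2)] by auto
    with L(3) show ?thesis by blast
  qed
  have upper: "k \<le> n"
    if L: "\<forall>i\<le>k. submodule (L i) R M" "\<forall>i<k. L i \<subset> L (Suc i)" for k and L :: "nat \<Rightarrow> 'b set"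
  proof -
    have fin: "finite (jumps S)" for S unfolding jumps_def by simp
    have "i \<le> card (jumps (L i))" if "i \<le> k" for i
      using that
    proof (induction i)
      case (Suc i)
      then have sl: "submodule (L i) R M" "submodule (L (Suc i)) R M" "L i \<subset> L (Suc i)"
        using L by auto
      then have "jumps (L i) \<subset> jumps (L (Suc i))"
        using jumps_mono[of "L i" "L (Suc i)"] jumps_inj[of "L i" "L (Suc i)"] by blast
      then have "card (jumps (L i)) < card (jumps (L (Suc i)))"
        by (rule psubset_card_mono[OF fin])
      then show ?case
        using Suc.IH Suc.prems by linarith
    qed simp
    from this[of k] have "k \<le> card (jumps (L k))" by simp
    also have "\<dots> \<le> card {..<n}"
      by (rule card_mono) (auto simp: jumps_def)
    finally show ?thesis by simp
  qed
  show ?thesis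
    unfolding mod_length_def
  proof (rule antisym)
    show "(SUP k\<in>{k. \<exists>N. (\<forall>i\<le>k. submodule (N i) R M) \<and> (\<forall>i<k. N i \<subset> N (Suc i))}. enat k) \<le> enat n"
      by (rule SUP_least) (use upper in auto)
    show "enat n \<le> (SUP k\<in>{k. \<exists>N. (\<forall>i\<le>k. submodule (N i) R M) \<and> (\<forall>i<k. N i \<subset> N (Suc i))}. enat k)"
      by (rule SUP_upper) (use sub strict in blast)
  qed
qed

section \<open>Localization\<close>

locale localization = module R M + prime: primeideal p R
  for R :: "('a, 'r) ring_scheme" (structure) and M :: "('a, 'b, 'm) module_scheme" (structure) and p

context localization
begin

abbreviation denoms where "denoms \<equiv> carrier R - p"

lemma denoms_one: "\<one> \<in> denoms"
  using prime.one_imp_carrier prime.I_notcarr by auto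

lemma denoms_mult: "s \<in> denoms \<Longrightarrow> t \<in> denoms \<Longrightarrow> s \<otimes> t \<in> denoms"
  using prime.I_prime by auto

lemma loc_rel_iff:
  "((m, s), (m', s')) \<in> loc_rel R M p \<longleftrightarrow>
     m \<in> carrier M \<and> m' \<in> carrier M \<and> s \<in> denoms \<and> s' \<in> denoms \<and>
     (\<exists>u\<in>denoms. u \<odot>\<^bsub>M\<^esub> (s' \<odot>\<^bsub>M\<^esub> m) = u \<odot>\<^bsub>M\<^esub> (s \<odot>\<^bsub>M\<^esub> m'))"
  by (simp add: loc_rel_def)

lemma loc_rel_equiv: "equiv (carrier M \<times> denoms) (loc_rel R M p)"
proof (rule equivI)
  show "loc_rel R M p \<subseteq> (carrier M \<times> denoms) \<times> (carrier M \<times> denoms)"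
    by (auto simp: loc_rel_def)
  show "refl_on (carrier M \<times> denoms) (loc_rel R M p)"
    using denoms_one by (auto simp: refl_on_def loc_rel_iff)
  show "sym (loc_rel R M p)"
    by (rule symI) (clarsimp simp: loc_rel_def, metis DiffI)
  show "trans (loc_rel R M p)"
  proof (rule transI)
    fix U V W assume XY: "(U, V) \<in> loc_rel R M p" and YZ: "(V, W) \<in> loc_rel R M p"
    obtain x s y t z v where [simp]: "U = (x, s)" "V = (y, t)" "W = (z, v)"
      by (cases U; cases V; cases W)
    from XY YZ have mem: "x \<in> carrier M" "y \<in> carrier M" "z \<in> carrier M" "s \<in> denoms" "t \<in> denoms" "v \<in> denoms"
      by (auto simp: loc_rel_iff)
    obtain u where u: "u \<in> denoms" "u \<odot>\<^bsub>M\<^esub> (t \<odot>\<^bsub>M\<^esub> x) = u \<odot>\<^bsub>M\<^esub> (s \<odot>\<^bsub>M\<^esub> y)"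
      using XY by (auto simp: loc_rel_iff)
    obtain w where w: "w \<in> denoms" "w \<odot>\<^bsub>M\<^esub> (v \<odot>\<^bsub>M\<^esub> y) = w \<odot>\<^bsub>M\<^esub> (t \<odot>\<^bsub>M\<^esub> z)"
      using YZ by (auto simp: loc_rel_iff)
    have "(u \<otimes> w \<otimes> t) \<odot>\<^bsub>M\<^esub> (v \<odot>\<^bsub>M\<^esub> x) = (w \<otimes> v) \<odot>\<^bsub>M\<^esub> (u \<odot>\<^bsub>M\<^esub> (t \<odot>\<^bsub>M\<^esub> x))"
      using mem u(1) w(1) by (simp add: smult_assoc1[symmetric] m_ac)
    also have "\<dots> = (w \<otimes> v) \<odot>\<^bsub>M\<^esub> (u \<odot>\<^bsub>M\<^esub> (s \<odot>\<^bsub>M\<^esub> y))"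
      by (simp only: u(2))
    also have "\<dots> = (u \<otimes> s) \<odot>\<^bsub>M\<^esub> (w \<odot>\<^bsub>M\<^esub> (v \<odot>\<^bsub>M\<^esub> y))"
      using mem u(1) w(1) by (simp add: smult_assoc1[symmetric] m_ac)
    also have "\<dots> = (u \<otimes> s) \<odot>\<^bsub>M\<^esub> (w \<odot>\<^bsub>M\<^esub> (t \<odot>\<^bsub>M\<^esub> z))"
      by (simp only: w(2))
    also have "\<dots> = (u \<otimes> w \<otimes> t) \<odot>\<^bsub>M\<^esub> (s \<odot>\<^bsub>M\<^esub> z)"
      using mem u(1) w(1) by (simp add: smult_assoc1[symmetric] m_ac)
    finally show "(U, W) \<in> loc_rel R M p"
      using mem denoms_mult[OF denoms_mult[OF u(1) w(1)], of t] by (auto simp: loc_rel_iff)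
  qed
qed

lemma loc_frac_eq_iff:
  assumes "m \<in> carrier M" "s \<in> denoms" "m' \<in> carrier M" "s' \<in> denoms"
  shows "loc_frac R M p m s = loc_frac R M p m' s' \<longleftrightarrow>
    (\<exists>u\<in>denoms. u \<odot>\<^bsub>M\<^esub> (s' \<odot>\<^bsub>M\<^esub> m) = u \<odot>\<^bsub>M\<^esub> (s \<odot>\<^bsub>M\<^esub> m'))"
  unfolding loc_frac_def using assms
  by (subst eq_equiv_class_iff[OF loc_rel_equiv]) (auto simp: loc_rel_iff)

lemma loc_frac_eqI:
  assumes "m \<in> carrier M" "s \<in> denoms" "m' \<in> carrier M" "s' \<in> denoms" "s' \<odot>\<^bsub>M\<^esub> m = s \<odot>\<^bsub>M\<^esub> m'"
  shows "loc_frac R M p m s = loc_frac R M p m' s'"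
  using assms denoms_one loc_frac_eq_iff by auto

lemma mem_loc_frac_iff:
  assumes "m \<in> carrier M" "s \<in> denoms"
  shows "(m', s') \<in> loc_frac R M p m s \<longleftrightarrow>
    m' \<in> carrier M \<and> s' \<in> denoms \<and> loc_frac R M p m' s' = loc_frac R M p m s"
proof -
  have "(m', s') \<in> loc_frac R M p m s \<longleftrightarrow> ((m, s), (m', s')) \<in> loc_rel R M p"
    by (simp add: loc_frac_def)
  also have "\<dots> \<longleftrightarrow> m' \<in> carrier M \<and> s' \<in> denoms \<and> loc_frac R M p m s = loc_frac R M p m' s'"
    using assms loc_frac_eq_iff[of m s m' s'] by (auto simp: loc_rel_iff)
  finally show ?thesis by auto
qed

lemma loc_frac_self: "m \<in> carrier M \<Longrightarrow> s \<in> denoms \<Longrightarrow> (m, s) \<in> loc_frac R M p m s"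
  by (simp add: mem_loc_frac_iff)

lemma loc_carrier_eq: "loc_carrier R M p = {loc_frac R M p m s | m s. m \<in> carrier M \<and> s \<in> denoms}"
  unfolding loc_carrier_def quotient_def loc_frac_def by auto

lemma loc_frac_scale:
  assumes "t \<in> denoms" "m \<in> carrier M" "s \<in> denoms"
  shows "loc_frac R M p (t \<odot>\<^bsub>M\<^esub> m) (t \<otimes> s) = loc_frac R M p m s"
  using assms denoms_mult
  by (intro loc_frac_eqI) (auto simp: smult_assoc1[symmetric] m_comm)

lemma loc_frac_common:
  assumes "m \<in> carrier M" "s \<in> denoms" "m' \<in> carrier M" "s' \<in> denoms"
  shows "loc_frac R M p m s = loc_frac R M p (s' \<odot>\<^bsub>M\<^esub> m) (s' \<otimes> s)"
    "loc_frac R M p m' s' = loc_frac R M p (s \<odot>\<^bsub>M\<^esub> m') (s' \<otimes> s)"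
  using loc_frac_scale[of s' m s] loc_frac_scale[of s m' s'] assms m_comm[of s s'] by auto

lemma loc_add_frac:
  assumes "m \<in> carrier M" "s \<in> denoms" "m' \<in> carrier M" "s' \<in> denoms"
  shows "loc_add R M p (loc_frac R M p m s) (loc_frac R M p m' s')
    = loc_frac R M p (s' \<odot>\<^bsub>M\<^esub> m \<oplus>\<^bsub>M\<^esub> s \<odot>\<^bsub>M\<^esub> m') (s \<otimes> s')"
proof -
  have "loc_frac R M p (t' \<odot>\<^bsub>M\<^esub> x \<oplus>\<^bsub>M\<^esub> t \<odot>\<^bsub>M\<^esub> x') (t \<otimes> t')
      = loc_frac R M p (s' \<odot>\<^bsub>M\<^esub> m \<oplus>\<^bsub>M\<^esub> s \<odot>\<^bsub>M\<^esub> m') (s \<otimes> s')"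
    if xt: "(x, t) \<in> loc_frac R M p m s" and xt': "(x', t') \<in> loc_frac R M p m' s'" for x t x' t'
  proof -
    have mem: "x \<in> carrier M" "t \<in> denoms" "x' \<in> carrier M" "t' \<in> denoms"
      using xt xt' assms by (auto simp: mem_loc_frac_iff)
    obtain u where u: "u \<in> denoms" "u \<odot>\<^bsub>M\<^esub> (s \<odot>\<^bsub>M\<^esub> x) = u \<odot>\<^bsub>M\<^esub> (t \<odot>\<^bsub>M\<^esub> m)"
      using xt assms mem by (auto simp: mem_loc_frac_iff loc_frac_eq_iff)
    obtain w where w: "w \<in> denoms" "w \<odot>\<^bsub>M\<^esub> (s' \<odot>\<^bsub>M\<^esub> x') = w \<odot>\<^bsub>M\<^esub> (t' \<odot>\<^bsub>M\<^esub> m')"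
      using xt' assms mem by (auto simp: mem_loc_frac_iff loc_frac_eq_iff)
    have "(u \<otimes> w) \<odot>\<^bsub>M\<^esub> ((s \<otimes> s') \<odot>\<^bsub>M\<^esub> (t' \<odot>\<^bsub>M\<^esub> x \<oplus>\<^bsub>M\<^esub> t \<odot>\<^bsub>M\<^esub> x'))
        = (w \<otimes> s' \<otimes> t') \<odot>\<^bsub>M\<^esub> (u \<odot>\<^bsub>M\<^esub> (s \<odot>\<^bsub>M\<^esub> x)) \<oplus>\<^bsub>M\<^esub> (u \<otimes> s \<otimes> t) \<odot>\<^bsub>M\<^esub> (w \<odot>\<^bsub>M\<^esub> (s' \<odot>\<^bsub>M\<^esub> x'))"
      using mem assms u(1) w(1) by (simp add: smult_r_distr smult_assoc1[symmetric] m_ac)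
    also have "\<dots> = (w \<otimes> s' \<otimes> t') \<odot>\<^bsub>M\<^esub> (u \<odot>\<^bsub>M\<^esub> (t \<odot>\<^bsub>M\<^esub> m)) \<oplus>\<^bsub>M\<^esub> (u \<otimes> s \<otimes> t) \<odot>\<^bsub>M\<^esub> (w \<odot>\<^bsub>M\<^esub> (t' \<odot>\<^bsub>M\<^esub> m'))"
      by (simp only: u(2) w(2))
    also have "\<dots> = (u \<otimes> w) \<odot>\<^bsub>M\<^esub> ((t \<otimes> t') \<odot>\<^bsub>M\<^esub> (s' \<odot>\<^bsub>M\<^esub> m \<oplus>\<^bsub>M\<^esub> s \<odot>\<^bsub>M\<^esub> m'))"
      using mem assms u(1) w(1) by (simp add: smult_r_distr smult_assoc1[symmetric] m_ac)
    finally show ?thesis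
      using mem assms denoms_mult u(1) w(1) by (subst loc_frac_eq_iff) auto
  qed
  then show ?thesis
    unfolding loc_add_def using loc_frac_self[OF assms(1,2)] loc_frac_self[OF assms(3,4)] by blast
qed

lemma loc_add_frac_same:
  assumes "m \<in> carrier M" "s \<in> denoms" "m' \<in> carrier M"
  shows "loc_add R M p (loc_frac R M p m s) (loc_frac R M p m' s) = loc_frac R M p (m \<oplus>\<^bsub>M\<^esub> m') s"
  using assms denoms_mult loc_frac_scale[of s "m \<oplus>\<^bsub>M\<^esub> m'" s]
  by (subst loc_add_frac) (auto simp: smult_r_distr)

lemma loc_frac_zero: "s \<in> denoms \<Longrightarrow> loc_frac R M p \<zero>\<^bsub>M\<^esub> s = loc_frac R M p \<zero>\<^bsub>M\<^esub> \<one>"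
  using denoms_one by (intro loc_frac_eqI) auto

lemma loc_frac_eq_zero_iff:
  assumes "m \<in> carrier M" "s \<in> denoms"
  shows "loc_frac R M p m s = loc_frac R M p \<zero>\<^bsub>M\<^esub> \<one> \<longleftrightarrow> (\<exists>u\<in>denoms. u \<odot>\<^bsub>M\<^esub> m = \<zero>\<^bsub>M\<^esub>)"
  using assms denoms_one by (subst loc_frac_eq_iff) auto

lemma loc_module_simps:
  "carrier (loc_module R M p) = {loc_frac R M p m s | m s. m \<in> carrier M \<and> s \<in> denoms}"
  "\<zero>\<^bsub>loc_module R M p\<^esub> = loc_frac R M p \<zero>\<^bsub>M\<^esub> \<one>"
  "ring.add (loc_module R M p) = loc_add R M p"
  "module.smult (loc_module R M p) = loc_smult R M p"
  by (simp_all add: loc_module_def loc_carrier_eq)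

text \<open>Common denominators reduce the group axioms of the localization to those of the module.\<close>

lemma loc_common3:
  assumes "U \<in> carrier (loc_module R M p)" "V \<in> carrier (loc_module R M p)" "W \<in> carrier (loc_module R M p)"
  obtains x y z s where "s \<in> denoms" "x \<in> carrier M" "y \<in> carrier M" "z \<in> carrier M"
    "U = loc_frac R M p x s" "V = loc_frac R M p y s" "W = loc_frac R M p z s"
proof -
  obtain x s y t z v where mem: "x \<in> carrier M" "s \<in> denoms" "y \<in> carrier M" "t \<in> denoms" "z \<in> carrier M" "v \<in> denoms"
    and eq: "U = loc_frac R M p x s" "V = loc_frac R M p y t" "W = loc_frac R M p z v"
    using assms by (auto simp: loc_module_simps)
  show thesis
  proof
    show "U = loc_frac R M p (v \<odot>\<^bsub>M\<^esub> (t \<odot>\<^bsub>M\<^esub> x)) (v \<otimes> (t \<otimes> s))"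
      "V = loc_frac R M p (v \<odot>\<^bsub>M\<^esub> (s \<odot>\<^bsub>M\<^esub> y)) (v \<otimes> (t \<otimes> s))"
      using mem denoms_mult loc_frac_scale[of v "t \<odot>\<^bsub>M\<^esub> x" "t \<otimes> s"]
        loc_frac_scale[of v "s \<odot>\<^bsub>M\<^esub> y" "t \<otimes> s"] loc_frac_common[of x s y t] by (auto simp: eq)
    show "W = loc_frac R M p ((t \<otimes> s) \<odot>\<^bsub>M\<^esub> z) (v \<otimes> (t \<otimes> s))"
      using mem denoms_mult loc_frac_scale[of "t \<otimes> s" z v] m_comm[of v "t \<otimes> s"] by (auto simp: eq)
  qed (use mem denoms_mult in auto)
qed

lemma loc_module_abelian_group: "abelian_group (loc_module R M p)"
proof (rule abelian_groupI)
  let ?L = "loc_module R M p"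
  show "\<zero>\<^bsub>?L\<^esub> \<in> carrier ?L"
    using denoms_one by (auto simp: loc_module_simps)
  fix U V W assume XYZ: "U \<in> carrier ?L" "V \<in> carrier ?L" "W \<in> carrier ?L"
  then obtain x y z s where mem: "s \<in> denoms" "x \<in> carrier M" "y \<in> carrier M" "z \<in> carrier M"
    and eq: "U = loc_frac R M p x s" "V = loc_frac R M p y s" "W = loc_frac R M p z s"
    by (rule loc_common3)
  show "U \<oplus>\<^bsub>?L\<^esub> V \<in> carrier ?L"
    using mem by (auto simp: loc_module_simps eq loc_add_frac_same)
  show "U \<oplus>\<^bsub>?L\<^esub> V \<oplus>\<^bsub>?L\<^esub> W = U \<oplus>\<^bsub>?L\<^esub> (V \<oplus>\<^bsub>?L\<^esub> W)"
    using mem by (simp add: loc_module_simps eq loc_add_frac_same M.a_assoc)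
  show "U \<oplus>\<^bsub>?L\<^esub> V = V \<oplus>\<^bsub>?L\<^esub> U"
    using mem by (simp add: loc_module_simps eq loc_add_frac_same M.a_comm)
  show "\<zero>\<^bsub>?L\<^esub> \<oplus>\<^bsub>?L\<^esub> U = U"
    using mem loc_frac_zero[of s] loc_add_frac_same[of "\<zero>\<^bsub>M\<^esub>" s x]
    by (simp add: loc_module_simps eq)
  have "loc_frac R M p (\<ominus>\<^bsub>M\<^esub> x) s \<oplus>\<^bsub>?L\<^esub> U = \<zero>\<^bsub>?L\<^esub>"
    using mem loc_frac_zero[of s] by (simp add: loc_module_simps eq loc_add_frac_same M.l_neg)
  moreover have "loc_frac R M p (\<ominus>\<^bsub>M\<^esub> x) s \<in> carrier ?L"
    using mem by (auto simp: loc_module_simps)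
  ultimately show "\<exists>V\<in>carrier ?L. V \<oplus>\<^bsub>?L\<^esub> U = \<zero>\<^bsub>?L\<^esub>" by blast
qed

end

lemma (in cring) self_module_module: "module R (self_module R)"
proof (rule moduleI)
  show "abelian_group (self_module R)"
  proof (rule abelian_groupI)
    fix x assume "x \<in> carrier (self_module R)"
    then show "\<exists>y\<in>carrier (self_module R). y \<oplus>\<^bsub>self_module R\<^esub> x = \<zero>\<^bsub>self_module R\<^esub>"
      using l_neg by (auto simp: self_module_def intro!: bexI[of _ "\<ominus> x"])
  qed (simp_all add: self_module_def a_assoc, rule a_comm)
qed (auto simp: self_module_def l_distr r_distr m_assoc is_cring)

lemma self_module_simps [simp]:
  "carrier (self_module R) = carrier R" "\<zero>\<^bsub>self_module R\<^esub> = \<zero>\<^bsub>R\<^esub>"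
  "ring.add (self_module R) = ring.add R" "module.smult (self_module R) = monoid.mult R"
  by (simp_all add: self_module_def)

lemma ideal_power_0: "J [^]\<^bsub>ideals_set R\<^esub> (0::nat) = carrier R"
  by (simp add: nat_pow_def ideals_set_def)

lemma ideal_power_Suc: "J [^]\<^bsub>ideals_set R\<^esub> Suc k = ideal_prod R (J [^]\<^bsub>ideals_set R\<^esub> k) J"
  by (simp add: nat_pow_def ideals_set_def)

lemma (in ring) ideal_power_ideal:
  assumes "ideal J R"
  shows "ideal (J [^]\<^bsub>ideals_set R\<^esub> (k::nat)) R"
proof (induction k)
  case 0
  show ?case unfolding ideal_power_0 by (rule oneideal)
next
  case (Suc k)
  then show ?case unfolding ideal_power_Suc using assms by (rule ideal_prod_is_ideal)
qed

context localization
begin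

lemma self_localization: "localization R (self_module R) p"
  by (intro localization.intro self_module_module prime.primeideal_axioms)

interpretation self: localization R "self_module R" p
  by (rule self_localization)

text \<open>The action is given by a union over representatives; it is a single fraction because the
  result does not depend on the representatives.\<close>

lemma loc_smult_frac:
  assumes "r \<in> carrier R" "t \<in> denoms" "m \<in> carrier M" "s \<in> denoms"
  shows "loc_smult R M p (loc_frac R (self_module R) p r t) (loc_frac R M p m s)
    = loc_frac R M p (r \<odot>\<^bsub>M\<^esub> m) (t \<otimes> s)"
proof -
  have rt0: "(r, t) \<in> loc_frac R (self_module R) p r t"
    using assms by (intro self.loc_frac_self) auto
  have "loc_frac R M p (r' \<odot>\<^bsub>M\<^esub> m') (t' \<otimes> s') = loc_frac R M p (r \<odot>\<^bsub>M\<^esub> m) (t \<otimes> s)"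
    if rt: "(r', t') \<in> loc_frac R (self_module R) p r t" and ms: "(m', s') \<in> loc_frac R M p m s"
    for r' t' m' s'
  proof -
    have mem: "r' \<in> carrier R" "t' \<in> denoms" "m' \<in> carrier M" "s' \<in> denoms"
      using rt ms assms by (auto simp: mem_loc_frac_iff self.mem_loc_frac_iff)
    obtain u where u: "u \<in> denoms" "u \<otimes> (t \<otimes> r') = u \<otimes> (t' \<otimes> r)"
      using rt assms mem by (auto simp: self.mem_loc_frac_iff self.loc_frac_eq_iff)
    obtain w where w: "w \<in> denoms" "w \<odot>\<^bsub>M\<^esub> (s \<odot>\<^bsub>M\<^esub> m') = w \<odot>\<^bsub>M\<^esub> (s' \<odot>\<^bsub>M\<^esub> m)"
      using ms assms mem by (auto simp: mem_loc_frac_iff loc_frac_eq_iff)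
    have "(u \<otimes> w) \<odot>\<^bsub>M\<^esub> ((t \<otimes> s) \<odot>\<^bsub>M\<^esub> (r' \<odot>\<^bsub>M\<^esub> m'))
        = (u \<otimes> (t \<otimes> r')) \<odot>\<^bsub>M\<^esub> (w \<odot>\<^bsub>M\<^esub> (s \<odot>\<^bsub>M\<^esub> m'))"
      using mem assms u(1) w(1) by (simp add: smult_assoc1[symmetric] m_ac)
    also have "\<dots> = (u \<otimes> (t' \<otimes> r)) \<odot>\<^bsub>M\<^esub> (w \<odot>\<^bsub>M\<^esub> (s' \<odot>\<^bsub>M\<^esub> m))"
      by (simp only: u(2) w(2))
    also have "\<dots> = (u \<otimes> w) \<odot>\<^bsub>M\<^esub> ((t' \<otimes> s') \<odot>\<^bsub>M\<^esub> (r \<odot>\<^bsub>M\<^esub> m))"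
      using mem assms u(1) w(1) by (simp add: smult_assoc1[symmetric] m_ac)
    finally show ?thesis
      using mem assms denoms_mult[OF u(1) w(1)] denoms_mult by (subst loc_frac_eq_iff) auto
  qed
  then show ?thesis
    unfolding loc_smult_def using rt0 loc_frac_self[OF assms(3,4)] by blast
qed

end

context localization
begin

interpretation self: localization R "self_module R" p
  by (rule self_localization)

lemma loc_ring_simps:
  "carrier (loc_ring R p) = {loc_frac R (self_module R) p r t | r t. r \<in> carrier R \<and> t \<in> denoms}"
  "monoid.mult (loc_ring R p) = loc_smult R (self_module R) p"
  "ring.add (loc_ring R p) = loc_add R (self_module R) p"
  using self.loc_carrier_eq by (simp_all add: loc_ring_def)

text \<open>The localization of \<open>N\<close> inside the localization of \<open>M\<close>.\<close>

definition loc_sub :: "'b set \<Rightarrow> ('b \<times> 'a) set set" where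
  "loc_sub N = {loc_frac R M p m s | m s. m \<in> N \<and> s \<in> denoms}"

lemma loc_sub_submodule:
  assumes N: "submodule N R M"
  shows "submodule (loc_sub N) (loc_ring R p) (loc_module R M p)"
proof -
  interpret L: abelian_group "loc_module R M p" by (rule loc_module_abelian_group)
  note NM = submodule_mem_carrier[OF N]
  have neg: "\<ominus>\<^bsub>loc_module R M p\<^esub> loc_frac R M p m s = loc_frac R M p (\<ominus>\<^bsub>M\<^esub> m) s"
    if "m \<in> carrier M" "s \<in> denoms" for m s
    using that loc_frac_zero[of s]
    by (intro L.minus_equality) (auto simp: loc_module_simps loc_add_frac_same M.l_neg)
  have "subgroup (loc_sub N) (add_monoid (loc_module R M p))"
  proof (rule L.add.subgroupI)
    show "loc_sub N \<subseteq> carrier (loc_module R M p)"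
      using NM by (auto simp: loc_sub_def loc_module_simps)
    show "loc_sub N \<noteq> {}"
      using submodule_zero[OF N] denoms_one by (auto simp: loc_sub_def)
  next
    fix U assume "U \<in> loc_sub N"
    then obtain m s where ms: "m \<in> N" "s \<in> denoms" "U = loc_frac R M p m s"
      by (auto simp: loc_sub_def)
    have "\<ominus>\<^bsub>M\<^esub> m \<in> N"
      using submodule_diff[OF N submodule_zero[OF N] ms(1)] NM[OF ms(1)] by (simp add: a_minus_def)
    then show "\<ominus>\<^bsub>loc_module R M p\<^esub> U \<in> loc_sub N"
      using ms neg[OF NM ms(2)] by (auto simp: loc_sub_def)
  next
    fix U V assume "U \<in> loc_sub N" "V \<in> loc_sub N"
    then obtain m s m' s' where ms: "m \<in> N" "s \<in> denoms" "U = loc_frac R M p m s"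
      "m' \<in> N" "s' \<in> denoms" "V = loc_frac R M p m' s'"
      unfolding loc_sub_def by blast
    have "U \<oplus>\<^bsub>loc_module R M p\<^esub> V
        = loc_frac R M p (s' \<odot>\<^bsub>M\<^esub> m \<oplus>\<^bsub>M\<^esub> s \<odot>\<^bsub>M\<^esub> m') (s \<otimes> s')"
      using ms NM by (simp add: loc_module_simps loc_add_frac)
    moreover have "s' \<odot>\<^bsub>M\<^esub> m \<oplus>\<^bsub>M\<^esub> s \<odot>\<^bsub>M\<^esub> m' \<in> N"
      using ms submodule.smult_closed[OF N] submodule_add[OF N] by auto
    ultimately show "U \<oplus>\<^bsub>loc_module R M p\<^esub> V \<in> loc_sub N"
      using denoms_mult[OF ms(2,5)] unfolding loc_sub_def by blast
  qed
  moreover have "A \<odot>\<^bsub>loc_module R M p\<^esub> U \<in> loc_sub N"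
    if "A \<in> carrier (loc_ring R p)" "U \<in> loc_sub N" for A U
  proof -
    obtain r t m s where rt: "r \<in> carrier R" "t \<in> denoms" "A = loc_frac R (self_module R) p r t"
      and ms: "m \<in> N" "s \<in> denoms" "U = loc_frac R M p m s"
      using \<open>A \<in> carrier (loc_ring R p)\<close> \<open>U \<in> loc_sub N\<close>
      unfolding loc_ring_simps loc_sub_def by blast
    have "A \<odot>\<^bsub>loc_module R M p\<^esub> U = loc_frac R M p (r \<odot>\<^bsub>M\<^esub> m) (t \<otimes> s)"
      using rt ms NM by (simp add: loc_module_simps loc_smult_frac)
    moreover have "r \<odot>\<^bsub>M\<^esub> m \<in> N"
      using rt ms submodule.smult_closed[OF N] by auto
    ultimately show ?thesis
      using denoms_mult[OF rt(2) ms(2)] unfolding loc_sub_def by blast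
  qed
  ultimately show ?thesis
    by (intro submodule.intro submodule_axioms.intro)
qed

text \<open>For a saturated submodule (one that contains \<open>m\<close> as soon as it contains \<open>u m\<close> for some \<open>u \<notin> p\<close>), membership
  of a fraction in its localization can be read off the numerator.\<close>

lemma loc_frac_mem_loc_sub_iff:
  assumes N: "submodule N R M"
    and sat: "\<And>u m. u \<in> denoms \<Longrightarrow> m \<in> carrier M \<Longrightarrow> u \<odot>\<^bsub>M\<^esub> m \<in> N \<Longrightarrow> m \<in> N"
    and ms: "m \<in> carrier M" "s \<in> denoms"
  shows "loc_frac R M p m s \<in> loc_sub N \<longleftrightarrow> m \<in> N"
proof
  assume "loc_frac R M p m s \<in> loc_sub N"
  then obtain n t where nt: "n \<in> N" "t \<in> denoms" "loc_frac R M p m s = loc_frac R M p n t"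
    by (auto simp: loc_sub_def)
  then obtain u where u: "u \<in> denoms" "u \<odot>\<^bsub>M\<^esub> (t \<odot>\<^bsub>M\<^esub> m) = u \<odot>\<^bsub>M\<^esub> (s \<odot>\<^bsub>M\<^esub> n)"
    using ms submodule_mem_carrier[OF N] by (auto simp: loc_frac_eq_iff)
  have "u \<odot>\<^bsub>M\<^esub> (s \<odot>\<^bsub>M\<^esub> n) \<in> N"
    using u(1) ms(2) nt(1) submodule.smult_closed[OF N] by auto
  then have "t \<odot>\<^bsub>M\<^esub> m \<in> N"
    using sat[of u "t \<odot>\<^bsub>M\<^esub> m"] u ms nt(2) by auto
  then show "m \<in> N"
    using sat[of t m] nt(2) ms by auto
qed (use ms in \<open>auto simp: loc_sub_def\<close>)

text \<open>With \<open>loc_ideal_power_mem\<close>: powers of the maximal ideal of the localization are the localized powers of the prime.\<close>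

lemma loc_ideal_power_sub:
  assumes "U \<in> loc_ideal R p [^]\<^bsub>ideals_set (loc_ring R p)\<^esub> (k::nat)"
  shows "\<exists>q\<in>p [^]\<^bsub>ideals_set R\<^esub> k. \<exists>s\<in>denoms. U = loc_frac R (self_module R) p q s"
  using assms
proof (induction k arbitrary: U)
  case 0
  then show ?case unfolding ideal_power_0 loc_ring_simps by blast
next
  case (Suc k)
  note id = ideal_power_ideal[OF prime.ideal_axioms]
  have car: "q \<in> carrier R" if "q \<in> p [^]\<^bsub>ideals_set R\<^esub> k" for q and k :: nat
    using ideal.Icarr[OF id that] .
  from Suc.prems show ?case
    unfolding ideal_power_Suc[where R = "loc_ring R p"]
  proof (induction U rule: ideal_prod.induct)
    case (prod i j)
    obtain q s where q: "q \<in> p [^]\<^bsub>ideals_set R\<^esub> k" "s \<in> denoms" "i = loc_frac R (self_module R) p q s"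
      using Suc.IH[OF prod(1)] by blast
    obtain a t where a: "a \<in> p" "t \<in> denoms" "j = loc_frac R (self_module R) p a t"
      using prod(2) unfolding loc_ideal_def by blast
    have "i \<otimes>\<^bsub>loc_ring R p\<^esub> j = loc_frac R (self_module R) p (q \<otimes> a) (s \<otimes> t)"
      using q a car self.loc_smult_frac[of q s a t] prime.Icarr by (simp add: loc_ring_simps)
    moreover have "q \<otimes> a \<in> p [^]\<^bsub>ideals_set R\<^esub> Suc k"
      unfolding ideal_power_Suc using q(1) a(1) by (rule ideal_prod.prod)
    ultimately show ?case
      using denoms_mult[OF q(2) a(2)] by blast
  next
    case (sum U V)
    obtain q s where q: "q \<in> p [^]\<^bsub>ideals_set R\<^esub> Suc k" "s \<in> denoms" "U = loc_frac R (self_module R) p q s"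
      using sum by blast
    obtain a t where a: "a \<in> p [^]\<^bsub>ideals_set R\<^esub> Suc k" "t \<in> denoms" "V = loc_frac R (self_module R) p a t"
      using sum by blast
    have "U \<oplus>\<^bsub>loc_ring R p\<^esub> V = loc_frac R (self_module R) p (t \<otimes> q \<oplus> s \<otimes> a) (s \<otimes> t)"
      using q(2,3) a(2,3) car[OF q(1)] car[OF a(1)] self.loc_add_frac[of q s a t]
      by (simp add: loc_ring_simps)
    moreover have "t \<otimes> q \<oplus> s \<otimes> a \<in> p [^]\<^bsub>ideals_set R\<^esub> Suc k"
      using q(2) a(2) ideal.I_l_closed[OF id q(1)] ideal.I_l_closed[OF id a(1)]
      by (intro additive_subgroup.a_closed[OF ideal.axioms(1)[OF id]]) auto
    ultimately show ?case
      using denoms_mult[OF q(2) a(2)] by blast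
  qed
qed

lemma loc_ideal_power_mem:
  assumes "q \<in> p [^]\<^bsub>ideals_set R\<^esub> (k::nat)"
  shows "loc_frac R (self_module R) p q \<one> \<in> loc_ideal R p [^]\<^bsub>ideals_set (loc_ring R p)\<^esub> k"
  using assms
proof (induction k arbitrary: q)
  case 0
  then show ?case using denoms_one unfolding ideal_power_0 loc_ring_simps by blast
next
  case (Suc k)
  note id = ideal_power_ideal[OF prime.ideal_axioms]
  have car: "q \<in> carrier R" if "q \<in> p [^]\<^bsub>ideals_set R\<^esub> k" for q and k :: nat
    using ideal.Icarr[OF id that] .
  from Suc.prems show ?case
    unfolding ideal_power_Suc
  proof (induction q rule: ideal_prod.induct)
    case (prod i j)
    have "loc_frac R (self_module R) p (i \<otimes> j) \<one>
        = loc_frac R (self_module R) p i \<one> \<otimes>\<^bsub>loc_ring R p\<^esub> loc_frac R (self_module R) p j \<one>"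
      using prod car denoms_one prime.Icarr self.loc_smult_frac[of i \<one> j \<one>]
      by (simp add: loc_ring_simps)
    moreover have "loc_frac R (self_module R) p j \<one> \<in> loc_ideal R p"
      using prod denoms_one unfolding loc_ideal_def by blast
    ultimately show ?case
      using ideal_prod.prod[OF Suc.IH[OF prod(1)]] by simp
  next
    case (sum a b)
    have ab: "a \<in> carrier R" "b \<in> carrier R"
      using sum(1,2) car[of _ "Suc k"] unfolding ideal_power_Suc by auto
    have "loc_frac R (self_module R) p (a \<oplus> b) \<one>
        = loc_frac R (self_module R) p a \<one> \<oplus>\<^bsub>loc_ring R p\<^esub> loc_frac R (self_module R) p b \<one>"
      using ab denoms_one self.loc_add_frac_same[of a \<one> b] by (simp add: loc_ring_simps)
    then show ?case
      using ideal_prod.sum[OF sum.IH] by simp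
  qed
qed

text \<open>Clearing denominators turns torsion over the localized ring into a condition on the numerator that
  only mentions the original ring and module.\<close>

lemma H0_loc_frac_iff:
  assumes ms: "m \<in> carrier M" "s \<in> denoms"
  shows "loc_frac R M p m s \<in> H0 (loc_ring R p) (loc_ideal R p) (loc_module R M p) \<longleftrightarrow>
    (\<exists>k::nat. \<forall>q \<in> p [^]\<^bsub>ideals_set R\<^esub> k. \<exists>u\<in>denoms. u \<odot>\<^bsub>M\<^esub> (q \<odot>\<^bsub>M\<^esub> m) = \<zero>\<^bsub>M\<^esub>)"
proof -
  have car: "q \<in> carrier R" if "q \<in> p [^]\<^bsub>ideals_set R\<^esub> k" for q and k :: nat
    using ideal.Icarr[OF ideal_power_ideal[OF prime.ideal_axioms] that] .
  have kill: "loc_frac R (self_module R) p q t \<odot>\<^bsub>loc_module R M p\<^esub> loc_frac R M p m s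
        = \<zero>\<^bsub>loc_module R M p\<^esub> \<longleftrightarrow> (\<exists>u\<in>denoms. u \<odot>\<^bsub>M\<^esub> (q \<odot>\<^bsub>M\<^esub> m) = \<zero>\<^bsub>M\<^esub>)"
    if "q \<in> carrier R" "t \<in> denoms" for q t
    using that ms denoms_mult[OF that(2) ms(2)]
    by (simp only: loc_module_simps loc_smult_frac loc_frac_eq_zero_iff smult_closed)
  have "(\<forall>A \<in> loc_ideal R p [^]\<^bsub>ideals_set (loc_ring R p)\<^esub> k.
          A \<odot>\<^bsub>loc_module R M p\<^esub> loc_frac R M p m s = \<zero>\<^bsub>loc_module R M p\<^esub>) \<longleftrightarrow>
      (\<forall>q \<in> p [^]\<^bsub>ideals_set R\<^esub> k. \<exists>u\<in>denoms. u \<odot>\<^bsub>M\<^esub> (q \<odot>\<^bsub>M\<^esub> m) = \<zero>\<^bsub>M\<^esub>)" for k :: nat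
  proof (intro iffI ballI)
    fix q assume "\<forall>A \<in> loc_ideal R p [^]\<^bsub>ideals_set (loc_ring R p)\<^esub> k.
          A \<odot>\<^bsub>loc_module R M p\<^esub> loc_frac R M p m s = \<zero>\<^bsub>loc_module R M p\<^esub>"
      and q: "q \<in> p [^]\<^bsub>ideals_set R\<^esub> k"
    then show "\<exists>u\<in>denoms. u \<odot>\<^bsub>M\<^esub> (q \<odot>\<^bsub>M\<^esub> m) = \<zero>\<^bsub>M\<^esub>"
      using kill[OF car[OF q] denoms_one] loc_ideal_power_mem[OF q] by blast
  next
    fix A assume all: "\<forall>q \<in> p [^]\<^bsub>ideals_set R\<^esub> k. \<exists>u\<in>denoms. u \<odot>\<^bsub>M\<^esub> (q \<odot>\<^bsub>M\<^esub> m) = \<zero>\<^bsub>M\<^esub>"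
      and "A \<in> loc_ideal R p [^]\<^bsub>ideals_set (loc_ring R p)\<^esub> k"
    then obtain q t where q: "q \<in> p [^]\<^bsub>ideals_set R\<^esub> k" "t \<in> denoms" "A = loc_frac R (self_module R) p q t"
      using loc_ideal_power_sub by blast
    show "A \<odot>\<^bsub>loc_module R M p\<^esub> loc_frac R M p m s = \<zero>\<^bsub>loc_module R M p\<^esub>"
      unfolding q(3) using kill[OF car[OF q(1)] q(2)] all q(1) by blast
  qed
  moreover have "loc_frac R M p m s \<in> carrier (loc_module R M p)"
    using ms unfolding loc_module_simps by blast
  ultimately show ?thesis
    unfolding H0_def by simp
qed

text \<open>Transports \<open>mod_length_filtration\<close> to the localization.  Saturation keeps the steps strict after
  localizing, and a step is simple there once it is simple up to a denominator \<open>t\<close>.\<close>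

lemma local_mult_filtration:
  fixes N :: "nat \<Rightarrow> 'b set"
  assumes sub: "\<And>i. i \<le> n \<Longrightarrow> submodule (N i) R M"
    and sat: "\<And>i u m. i \<le> n \<Longrightarrow> u \<in> denoms \<Longrightarrow> m \<in> carrier M \<Longrightarrow> u \<odot>\<^bsub>M\<^esub> m \<in> N i \<Longrightarrow> m \<in> N i"
    and bot: "\<And>m. m \<in> N 0 \<Longrightarrow> \<exists>u\<in>denoms. u \<odot>\<^bsub>M\<^esub> m = \<zero>\<^bsub>M\<^esub>"
    and top: "\<And>m. m \<in> carrier M \<Longrightarrow>
      m \<in> N n \<longleftrightarrow> (\<exists>k::nat. \<forall>q \<in> p [^]\<^bsub>ideals_set R\<^esub> k. q \<odot>\<^bsub>M\<^esub> m \<in> N 0)"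
    and strict: "\<And>i. i < n \<Longrightarrow> N i \<subset> N (Suc i)"
    and simple: "\<And>i x y. i < n \<Longrightarrow> x \<in> N (Suc i) \<Longrightarrow> y \<in> N (Suc i) - N i
      \<Longrightarrow> \<exists>t\<in>denoms. \<exists>r\<in>carrier R. \<exists>z\<in>N i. t \<odot>\<^bsub>M\<^esub> x = z \<oplus>\<^bsub>M\<^esub> r \<odot>\<^bsub>M\<^esub> y"
  shows "local_mult R M p = enat n"
proof -
  let ?L = "loc_module R M p"
  define H where "H = H0 (loc_ring R p) (loc_ideal R p) ?L"
  interpret L: abelian_group ?L by (rule loc_module_abelian_group)
  note NM = submodule_mem_carrier[OF sub]
  note locN = loc_sub_submodule[OF sub]
  have mem: "loc_frac R M p m s \<in> loc_sub (N i) \<longleftrightarrow> m \<in> N i"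
    if "i \<le> n" "m \<in> carrier M" "s \<in> denoms" for i m s
    by (rule loc_frac_mem_loc_sub_iff[OF sub[OF that(1)] sat[OF that(1)] that(2,3)])
  have bot_iff: "m \<in> N 0 \<longleftrightarrow> (\<exists>u\<in>denoms. u \<odot>\<^bsub>M\<^esub> m = \<zero>\<^bsub>M\<^esub>)" if "m \<in> carrier M" for m
  proof
    assume "\<exists>u\<in>denoms. u \<odot>\<^bsub>M\<^esub> m = \<zero>\<^bsub>M\<^esub>"
    then obtain u where "u \<in> denoms" "u \<odot>\<^bsub>M\<^esub> m \<in> N 0"
      using submodule_zero[OF sub[of 0]] by auto
    then show "m \<in> N 0" using sat[of 0 u m] that by blast
  qed (rule bot)
  have H_eq: "H = loc_sub (N n)"
  proof (rule Set.set_eqI)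
    fix U show "U \<in> H \<longleftrightarrow> U \<in> loc_sub (N n)"
    proof (cases "U \<in> carrier ?L")
      case True
      then obtain m s where ms: "m \<in> carrier M" "s \<in> denoms" "U = loc_frac R M p m s"
        by (auto simp: loc_module_simps)
      have car: "q \<odot>\<^bsub>M\<^esub> m \<in> carrier M" if "q \<in> p [^]\<^bsub>ideals_set R\<^esub> k" for q and k :: nat
        using ideal.Icarr[OF ideal_power_ideal[OF prime.ideal_axioms] that] ms(1) by simp
      have "U \<in> H \<longleftrightarrow> (\<exists>k::nat. \<forall>q \<in> p [^]\<^bsub>ideals_set R\<^esub> k. q \<odot>\<^bsub>M\<^esub> m \<in> N 0)"
        unfolding H_def ms(3) H0_loc_frac_iff[OF ms(1,2)] using bot_iff[OF car] by blast
      also have "\<dots> \<longleftrightarrow> U \<in> loc_sub (N n)"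
        unfolding ms(3) using mem[OF order_refl ms(1,2)] top[OF ms(1)] by blast
      finally show ?thesis .
    next
      case False
      then show ?thesis
        using submodule_mem_carrier[OF locN[of n]] unfolding H_def H0_def by auto
    qed
  qed
  have grp: "group (add_monoid ?L)" by (rule L.a_group)
  have addH: "add_monoid (?L\<lparr>carrier := H\<rparr>) = (add_monoid ?L)\<lparr>carrier := H\<rparr>" by simp
  have subH: "loc_sub (N i) \<subseteq> H" if "i \<le> n" for i
  proof -
    have "N i \<subseteq> N n"
      using that
    proof (induction rule: inc_induct)
      case (step j)
      then show ?case using strict[of j] by auto
    qed simp
    then show ?thesis unfolding H_eq loc_sub_def by blast
  qed
  have "mod_length (loc_ring R p) (?L\<lparr>carrier := H\<rparr>) = enat n"
  proof (rule mod_length_filtration)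
    have "comm_group ((add_monoid ?L)\<lparr>carrier := H\<rparr>)"
      unfolding H_eq
    proof (rule group.group_comm_groupI)
      show "group ((add_monoid ?L)\<lparr>carrier := loc_sub (N n)\<rparr>)"
        using submodule.axioms(1)[OF locN] grp by (intro subgroup.subgroup_is_group) auto
    qed (use submodule_mem_carrier[OF locN[OF order_refl]] L.a_comm in auto)
    then show "abelian_group (?L\<lparr>carrier := H\<rparr>)"
      unfolding abelian_group_def abelian_monoid_def abelian_group_axioms_def addH
      by (simp add: comm_group_def)
    show "submodule (loc_sub (N i)) (loc_ring R p) (?L\<lparr>carrier := H\<rparr>)" if "i \<le> n" for i
    proof (intro submodule.intro submodule_axioms.intro)
      show "subgroup (loc_sub (N i)) (add_monoid (?L\<lparr>carrier := H\<rparr>))"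
        unfolding addH
        by (rule group.subgroup_incl[OF grp])
          (use submodule.axioms(1)[OF locN] that subH[OF that] in \<open>auto simp: H_eq\<close>)
    qed (use submodule.smult_closed[OF locN[OF that]] in simp)
    show "loc_sub (N 0) = {\<zero>\<^bsub>?L\<lparr>carrier := H\<rparr>\<^esub>}"
    proof -
      have "loc_frac R M p m s = \<zero>\<^bsub>?L\<^esub>" if "m \<in> N 0" "s \<in> denoms" for m s
        using that bot[OF that(1)] NM[of 0 m] by (simp add: loc_module_simps loc_frac_eq_zero_iff)
      then show ?thesis
        using submodule_zero[OF locN[of 0]] by (auto simp: loc_sub_def)
    qed
    show "loc_sub (N n) = carrier (?L\<lparr>carrier := H\<rparr>)"
      by (simp add: H_eq)
    show "loc_sub (N i) \<subset> loc_sub (N (Suc i))" if i: "i < n" for i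
    proof -
      obtain m where m: "m \<in> N (Suc i)" "m \<notin> N i" using strict[OF i] by blast
      then have mM: "m \<in> carrier M" using NM[of "Suc i" m] i by simp
      have "loc_frac R M p m \<one> \<in> loc_sub (N (Suc i))"
        using m(1) denoms_one unfolding loc_sub_def by blast
      moreover have "loc_frac R M p m \<one> \<notin> loc_sub (N i)"
        using mem[of i m \<one>] m(2) mM denoms_one i by auto
      moreover have "loc_sub (N i) \<subseteq> loc_sub (N (Suc i))"
        using strict[OF i] unfolding loc_sub_def by blast
      ultimately show ?thesis by blast
    qed
    fix i U V assume i: "i < n" and U: "U \<in> loc_sub (N (Suc i))" and V: "V \<in> loc_sub (N (Suc i)) - loc_sub (N i)"
    obtain x s where x: "x \<in> N (Suc i)" "s \<in> denoms" "U = loc_frac R M p x s"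
      using U unfolding loc_sub_def by blast
    obtain y v where y: "y \<in> N (Suc i) - N i" "v \<in> denoms" "V = loc_frac R M p y v"
      using V unfolding loc_sub_def by blast
    have xy: "x \<in> carrier M" "y \<in> carrier M"
      using NM[of "Suc i"] x(1) y(1) i by auto
    obtain t r z where t: "t \<in> denoms" "r \<in> carrier R" "z \<in> N i" "t \<odot>\<^bsub>M\<^esub> x = z \<oplus>\<^bsub>M\<^esub> r \<odot>\<^bsub>M\<^esub> y"
      using simple[OF i x(1) y(1)] by blast
    have z: "z \<in> carrier M" using NM[of i z] t(3) i by simp
    define A where "A = loc_frac R (self_module R) p (r \<otimes> v) (t \<otimes> s)"
    define W where "W = loc_frac R M p z (t \<otimes> s)"
    have "A \<in> carrier (loc_ring R p)"
      unfolding A_def loc_ring_simps using t(2) y(2) denoms_mult[OF t(1) x(2)] by blast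
    moreover have "W \<in> loc_sub (N i)"
      unfolding W_def loc_sub_def using t(3) denoms_mult[OF t(1) x(2)] by blast
    moreover have "U = W \<oplus>\<^bsub>?L\<lparr>carrier := H\<rparr>\<^esub> A \<odot>\<^bsub>?L\<lparr>carrier := H\<rparr>\<^esub> V"
    proof -
      have ts: "t \<otimes> s \<in> denoms" using denoms_mult[OF t(1) x(2)] .
      have "A \<odot>\<^bsub>?L\<^esub> V = loc_frac R M p ((r \<otimes> v) \<odot>\<^bsub>M\<^esub> y) ((t \<otimes> s) \<otimes> v)"
        unfolding A_def y(3) using t(2) y(2) ts xy by (simp add: loc_module_simps loc_smult_frac)
      also have "\<dots> = loc_frac R M p (v \<odot>\<^bsub>M\<^esub> (r \<odot>\<^bsub>M\<^esub> y)) (v \<otimes> (t \<otimes> s))"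
        using t(2) y(2) ts xy m_comm[of v "t \<otimes> s"] smult_assoc1[of v r y] m_comm[of v r] by simp
      also have "\<dots> = loc_frac R M p (r \<odot>\<^bsub>M\<^esub> y) (t \<otimes> s)"
        using t(2) xy by (intro loc_frac_scale y(2) ts) simp
      finally have "W \<oplus>\<^bsub>?L\<^esub> A \<odot>\<^bsub>?L\<^esub> V = loc_frac R M p (z \<oplus>\<^bsub>M\<^esub> r \<odot>\<^bsub>M\<^esub> y) (t \<otimes> s)"
        unfolding W_def using t(2) xy z ts by (simp add: loc_module_simps loc_add_frac_same)
      also have "\<dots> = U"
        unfolding t(4)[symmetric] x(3) using xy(1) by (intro loc_frac_scale t(1) x(2))
      finally show ?thesis by simp
    qed
    ultimately show "\<exists>A\<in>carrier (loc_ring R p). \<exists>W\<in>loc_sub (N i).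
        U = W \<oplus>\<^bsub>?L\<lparr>carrier := H\<rparr>\<^esub> A \<odot>\<^bsub>?L\<lparr>carrier := H\<rparr>\<^esub> V" by blast
  qed
  then show ?thesis
    unfolding local_mult_def H_def .
qed

end


section \<open>Monomial ideals\<close>

lemma lookup_mult_sum:
  fixes f g :: "('n, 'k::field) mpoly"
  shows "Poly_Mapping.lookup (f * g) c =
    (\<Sum>a\<in>Poly_Mapping.keys f. \<Sum>b\<in>Poly_Mapping.keys g.
       if c = a + b then Poly_Mapping.lookup f a * Poly_Mapping.lookup g b else 0)"
proof -
  have inner: "(\<Sum>b. Poly_Mapping.lookup g b when c = a + b)
      = (\<Sum>b\<in>Poly_Mapping.keys g. Poly_Mapping.lookup g b when c = a + b)" for a
    by (rule Sum_any.expand_superset) (auto simp: in_keys_iff)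
  have "Poly_Mapping.lookup (f * g) c
      = (\<Sum>a. Poly_Mapping.lookup f a * (\<Sum>b\<in>Poly_Mapping.keys g. Poly_Mapping.lookup g b when c = a + b))"
    by (simp only: lookup_mult inner)
  also have "\<dots> = (\<Sum>a\<in>Poly_Mapping.keys f.
      Poly_Mapping.lookup f a * (\<Sum>b\<in>Poly_Mapping.keys g. Poly_Mapping.lookup g b when c = a + b))"
    by (rule Sum_any.expand_superset) (auto simp: in_keys_iff)
  also have "\<dots> = (\<Sum>a\<in>Poly_Mapping.keys f. \<Sum>b\<in>Poly_Mapping.keys g.
       if c = a + b then Poly_Mapping.lookup f a * Poly_Mapping.lookup g b else 0)"
    by (intro sum.cong refl) (auto simp: sum_distrib_left when_def intro!: sum.cong)
  finally show ?thesis .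
qed

text \<open>Two finite sets of exponents have a sum that, on the coordinates in \<open>V\<close>, is attained in one way only.  Such a sum is found by
  minimizing one coordinate after another in both sets; this plays the role of
  leading monomials when the variables carry no order.\<close>

lemma ex_unique_sum:
  fixes A B :: "('n \<Rightarrow>\<^sub>0 nat) set"
  assumes "finite V" "finite A" "finite B" "A \<noteq> {}" "B \<noteq> {}"
  shows "\<exists>a0\<in>A. \<exists>b0\<in>B. \<forall>a\<in>A. \<forall>b\<in>B.
    (\<forall>i\<in>V. Poly_Mapping.lookup (a + b) i = Poly_Mapping.lookup (a0 + b0) i) \<longrightarrow>
    (\<forall>i\<in>V. Poly_Mapping.lookup a i = Poly_Mapping.lookup a0 i
      \<and> Poly_Mapping.lookup b i = Poly_Mapping.lookup b0 i)"
  using assms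
proof (induction V arbitrary: A B)
  case empty
  then show ?case by auto
next
  case (insert v V)
  \<comment> \<open>The members of a set with the least coordinate \<open>v\<close>; a sum of two of them can only split into two of them.\<close>
  define low where "low C = {c \<in> C. \<forall>d\<in>C. Poly_Mapping.lookup c v \<le> Poly_Mapping.lookup d v}"
    for C :: "('n \<Rightarrow>\<^sub>0 nat) set"
  have low_ne: "low C \<noteq> {}" if "C \<noteq> {}" for C
    using ex_has_least_nat[of "\<lambda>c. c \<in> C" _ "\<lambda>c. Poly_Mapping.lookup c v"] that
    unfolding low_def by blast
  have low_fin: "finite C \<Longrightarrow> finite (low C)" for C unfolding low_def by simp
  obtain a0 b0 where ab: "a0 \<in> low A" "b0 \<in> low B" and
    uniq: "\<forall>a\<in>low A. \<forall>b\<in>low B.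
    (\<forall>i\<in>V. Poly_Mapping.lookup (a + b) i = Poly_Mapping.lookup (a0 + b0) i) \<longrightarrow>
    (\<forall>i\<in>V. Poly_Mapping.lookup a i = Poly_Mapping.lookup a0 i
      \<and> Poly_Mapping.lookup b i = Poly_Mapping.lookup b0 i)"
    using insert.IH[OF low_fin low_fin low_ne low_ne, OF insert.prems] by blast
  have "\<forall>i\<in>insert v V. Poly_Mapping.lookup a i = Poly_Mapping.lookup a0 i
      \<and> Poly_Mapping.lookup b i = Poly_Mapping.lookup b0 i"
    if "a \<in> A" "b \<in> B"
      and sum: "\<forall>i\<in>insert v V. Poly_Mapping.lookup (a + b) i = Poly_Mapping.lookup (a0 + b0) i" for a b
  proof -
    have "Poly_Mapping.lookup a0 v \<le> Poly_Mapping.lookup a v"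
      "Poly_Mapping.lookup b0 v \<le> Poly_Mapping.lookup b v"
      using ab that by (auto simp: low_def)
    moreover have "Poly_Mapping.lookup a v + Poly_Mapping.lookup b v
        = Poly_Mapping.lookup a0 v + Poly_Mapping.lookup b0 v"
      using sum by (simp add: lookup_add)
    ultimately have v: "Poly_Mapping.lookup a v = Poly_Mapping.lookup a0 v"
      "Poly_Mapping.lookup b v = Poly_Mapping.lookup b0 v" by auto
    then have "a \<in> low A" "b \<in> low B"
      using that ab by (auto simp: low_def)
    then show ?thesis using uniq sum v by simp
  qed
  then show ?case using ab unfolding low_def by blast
qed

definition mono_span :: "('n \<Rightarrow>\<^sub>0 nat) set \<Rightarrow> ('n, 'k::field) mpoly set" where
  "mono_span D = {f. Poly_Mapping.keys f \<subseteq> D}"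

text \<open>The exponent sets of ideals generated by monomials in the variables outside \<open>F\<close>.\<close>

definition stable_outside :: "'n set \<Rightarrow> ('n \<Rightarrow>\<^sub>0 nat) set \<Rightarrow> bool" where
  "stable_outside F D \<longleftrightarrow>
    (\<forall>a\<in>D. \<forall>b. (\<forall>i. i \<notin> F \<longrightarrow> Poly_Mapping.lookup a i \<le> Poly_Mapping.lookup b i) \<longrightarrow> b \<in> D)"

text \<open>The ideal generated by the variables outside \<open>F\<close>.\<close>

definition coord_prime :: "'n set \<Rightarrow> ('n, 'k::field) mpoly set" where
  "coord_prime F = mono_span {a. \<exists>i. i \<notin> F \<and> Poly_Mapping.lookup a i \<noteq> 0}"

lemma stable_outsideD:
  "stable_outside F D \<Longrightarrow> a \<in> D \<Longrightarrow>
    (\<And>i. i \<notin> F \<Longrightarrow> Poly_Mapping.lookup a i \<le> Poly_Mapping.lookup b i) \<Longrightarrow> b \<in> D"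
  unfolding stable_outside_def by blast

lemma stable_outside_add: "stable_outside F D \<Longrightarrow> b \<in> D \<Longrightarrow> a + b \<in> D"
  by (erule stable_outsideD) (auto simp: lookup_add)

lemma mono_span_zero [simp]: "0 \<in> mono_span D"
  by (simp add: mono_span_def)

lemma mono_span_add: "f \<in> mono_span D \<Longrightarrow> g \<in> mono_span D \<Longrightarrow> f + g \<in> mono_span D"
  using keys_add[of f g] by (auto simp: mono_span_def)

lemma mono_span_uminus: "f \<in> mono_span D \<Longrightarrow> - f \<in> mono_span D"
  by (auto simp: mono_span_def in_keys_iff subset_eq)

lemma mono_span_diff: "f \<in> mono_span D \<Longrightarrow> g \<in> mono_span D \<Longrightarrow> f - g \<in> mono_span D"
  using mono_span_add[OF _ mono_span_uminus] by fastforce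

lemma mono_span_mult:
  assumes "\<And>a b. b \<in> D \<Longrightarrow> a + b \<in> D" "g \<in> mono_span D"
  shows "f * g \<in> mono_span D"
  using keys_mult[of f g] assms unfolding mono_span_def by blast

lemma mono_span_mono: "D \<subseteq> E \<Longrightarrow> f \<in> mono_span D \<Longrightarrow> f \<in> mono_span E"
  by (auto simp: mono_span_def)

lemma single_mem_mono_span [simp]: "Poly_Mapping.single a (1 :: 'k::field) \<in> mono_span D \<longleftrightarrow> a \<in> D"
  by (simp add: mono_span_def)

lemma keys_single_mult:
  fixes f :: "('n, 'k::field) mpoly"
  shows "Poly_Mapping.keys (Poly_Mapping.single a 1 * f) = (+) a ` Poly_Mapping.keys f"
proof
  show "Poly_Mapping.keys (Poly_Mapping.single a 1 * f) \<subseteq> (+) a ` Poly_Mapping.keys f"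
    using keys_mult[of "Poly_Mapping.single a 1" f] by auto
  show "(+) a ` Poly_Mapping.keys f \<subseteq> Poly_Mapping.keys (Poly_Mapping.single a 1 * f)"
    by (auto simp: in_keys_iff lookup_mult_sum if_distrib sum.delta)
qed

lemma single_mult_mem_mono_span:
  "Poly_Mapping.single a 1 * f \<in> mono_span D \<longleftrightarrow> (\<forall>b\<in>Poly_Mapping.keys f. a + b \<in> D)"
  by (auto simp: mono_span_def keys_single_mult)

text \<open>Suppose \<open>f\<close> has exponents outside \<open>D\<close>, and let \<open>E\<close> collect those among them whose degree outside
  \<open>F\<close> is least.  Let \<open>A\<close> collect the exponents of \<open>u\<close> supported in \<open>F\<close>; they exist since \<open>u\<close> is not
  in the prime.  Take \<open>a0 \<in> A\<close> and \<open>b0 \<in> E\<close> whose sum is attained only once by \<open>A\<close> and \<open>E\<close>.  Any other way of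
  writing \<open>a0 + b0\<close> as a sum of exponents of \<open>u\<close> and \<open>f\<close> would also come from \<open>A\<close> and \<open>E\<close>, by stability of
  \<open>D\<close> and minimality.  So the coefficient of \<open>u f\<close> at \<open>a0 + b0\<close>, which is not in \<open>D\<close>, is nonzero.\<close>

lemma mono_span_cancel:
  fixes u f :: "('n::finite, 'k::field) mpoly"
  assumes D: "stable_outside F D" and uf: "u * f \<in> mono_span D" and u: "u \<notin> coord_prime F"
  shows "f \<in> mono_span D"
proof (rule ccontr)
  assume f: "f \<notin> mono_span D"
  define A where "A = {a \<in> Poly_Mapping.keys u. \<forall>i. i \<notin> F \<longrightarrow> Poly_Mapping.lookup a i = 0}"
  define deg where "deg b = (\<Sum>i\<in>-F. Poly_Mapping.lookup b i)" for b :: "'n \<Rightarrow>\<^sub>0 nat"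
  define E where "E = {b \<in> Poly_Mapping.keys f - D. \<forall>c\<in>Poly_Mapping.keys f - D. deg b \<le> deg c}"
  have "A \<noteq> {}" using u unfolding A_def coord_prime_def mono_span_def by auto
  moreover have "E \<noteq> {}"
    using ex_has_least_nat[of "\<lambda>b. b \<in> Poly_Mapping.keys f - D" _ deg] f
    unfolding E_def mono_span_def by blast
  moreover have "finite A" "finite E" unfolding A_def E_def by auto
  ultimately obtain a0 b0 where ab0: "a0 \<in> A" "b0 \<in> E" and
    uniq: "\<And>a b. a \<in> A \<Longrightarrow> b \<in> E \<Longrightarrow> a + b = a0 + b0 \<Longrightarrow> a = a0 \<and> b = b0"
    using ex_unique_sum[OF finite_UNIV, of A E] by (metis UNIV_I poly_mapping_eqI)
  have b0: "b0 \<in> Poly_Mapping.keys f" "b0 \<notin> D" and a0: "a0 \<in> Poly_Mapping.keys u"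
    and a0F: "\<And>i. i \<notin> F \<Longrightarrow> Poly_Mapping.lookup a0 i = 0"
    using ab0 by (auto simp: E_def A_def)
  have notD: "a0 + b0 \<notin> D"
    using b0(2) stable_outsideD[OF D, of "a0 + b0" b0] a0F by (auto simp: lookup_add)
  have only: "a = a0 \<and> b = b0"
    if a: "a \<in> Poly_Mapping.keys u" and b: "b \<in> Poly_Mapping.keys f" and eq: "a + b = a0 + b0" for a b
  proof -
    have sum: "Poly_Mapping.lookup a i + Poly_Mapping.lookup b i = Poly_Mapping.lookup b0 i" if "i \<notin> F" for i
      using arg_cong[OF eq, of "\<lambda>c. Poly_Mapping.lookup c i"] a0F[OF that] by (simp add: lookup_add)
    have bD: "b \<notin> D"
      using stable_outside_add[OF D, of b a] notD eq by auto
    have le: "deg b0 \<le> deg b" using ab0(2) b bD by (auto simp: E_def)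
    have "deg a + deg b = deg b0"
      unfolding deg_def sum.distrib[symmetric] by (rule sum.cong) (use sum in auto)
    then have "deg a = 0" "deg b = deg b0" using le by auto
    then have "a \<in> A" "b \<in> E"
      using a b bD ab0(2) by (auto simp: A_def E_def deg_def)
    then show ?thesis using uniq eq by blast
  qed
  have "Poly_Mapping.lookup (u * f) (a0 + b0)
      = (\<Sum>a\<in>Poly_Mapping.keys u. \<Sum>b\<in>Poly_Mapping.keys f.
          if b = b0 then if a = a0 then Poly_Mapping.lookup u a0 * Poly_Mapping.lookup f b0 else 0 else 0)"
    unfolding lookup_mult_sum
  proof (intro sum.cong refl)
    fix a b assume "a \<in> Poly_Mapping.keys u" "b \<in> Poly_Mapping.keys f"
    then show "(if a0 + b0 = a + b then Poly_Mapping.lookup u a * Poly_Mapping.lookup f b else 0)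
      = (if b = b0 then if a = a0 then Poly_Mapping.lookup u a0 * Poly_Mapping.lookup f b0 else 0 else 0)"
      using only[of a b] by auto
  qed
  also have "\<dots> = Poly_Mapping.lookup u a0 * Poly_Mapping.lookup f b0"
    using a0 b0(1) by (simp add: sum.delta)
  finally have "a0 + b0 \<in> Poly_Mapping.keys (u * f)"
    using a0 b0(1) by (simp add: in_keys_iff)
  then show False using uf notD by (auto simp: mono_span_def)
qed

lemma mpoly_ring_simps:
  "carrier mpoly_ring = UNIV" "monoid.mult mpoly_ring = (*)" "\<one>\<^bsub>mpoly_ring\<^esub> = 1"
  "\<zero>\<^bsub>mpoly_ring\<^esub> = 0" "ring.add mpoly_ring = (+)"
  by (simp_all add: ring_of_type_algebra_def)

lemma mpoly_cring: "cring (mpoly_ring :: ('n::finite, 'k::field) mpoly ring)"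
  by (rule cring_from_type_algebra)

lemma mpoly_uminus: "\<ominus>\<^bsub>mpoly_ring\<^esub> (f :: ('n::finite, 'k::field) mpoly) = - f"
proof -
  interpret cring "mpoly_ring :: ('n, 'k) mpoly ring" by (rule mpoly_cring)
  show ?thesis by (rule minus_equality) (simp_all add: mpoly_ring_simps)
qed

lemma mono_span_ideal:
  assumes "\<And>a b. b \<in> D \<Longrightarrow> a + b \<in> D"
  shows "ideal (mono_span D :: ('n::finite, 'k::field) mpoly set) mpoly_ring"
proof (rule idealI)
  interpret cring "mpoly_ring :: ('n, 'k) mpoly ring" by (rule mpoly_cring)
  show "ring (mpoly_ring :: ('n, 'k) mpoly ring)" by (rule ring_axioms)
  show "subgroup (mono_span D) (add_monoid (mpoly_ring :: ('n, 'k) mpoly ring))"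
  proof (rule add.subgroupI)
    show "(mono_span D :: ('n, 'k) mpoly set) \<noteq> {}" using mono_span_zero by blast
    show "\<ominus>\<^bsub>mpoly_ring\<^esub> f \<in> mono_span D" if "f \<in> mono_span D" for f :: "('n, 'k) mpoly"
      using mono_span_uminus[OF that] by (simp add: mpoly_uminus)
  qed (auto simp: mpoly_ring_simps mono_span_add)
  show "g \<otimes>\<^bsub>mpoly_ring\<^esub> f \<in> mono_span D" "f \<otimes>\<^bsub>mpoly_ring\<^esub> g \<in> mono_span D"
    if "f \<in> mono_span D" for f g :: "('n, 'k) mpoly"
    using mono_span_mult[OF assms that, of g] by (simp_all add: mpoly_ring_simps mult.commute)
qed

lemma stable_outside_support: "stable_outside F {a. \<exists>i. i \<notin> F \<and> Poly_Mapping.lookup a i \<noteq> 0}"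
  unfolding stable_outside_def by fastforce

lemma one_notin_coord_prime: "1 \<notin> coord_prime F"
  by (simp add: coord_prime_def mono_span_def)

lemma coord_prime_ideal: "ideal (coord_prime F :: ('n::finite, 'k::field) mpoly set) mpoly_ring"
  unfolding coord_prime_def
  by (rule mono_span_ideal) (rule stable_outside_add[OF stable_outside_support])

text \<open>Primality is the cancellation property for the exponents of the ideal itself.\<close>

lemma coord_prime_prime: "primeideal (coord_prime F :: ('n::finite, 'k::field) mpoly set) mpoly_ring"
proof (rule primeidealI)
  show "carrier mpoly_ring \<noteq> (coord_prime F :: ('n, 'k) mpoly set)"
    using one_notin_coord_prime by (auto simp: mpoly_ring_simps)
  fix u f :: "('n, 'k) mpoly"
  assume "u \<otimes>\<^bsub>mpoly_ring\<^esub> f \<in> coord_prime F"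
  then show "u \<in> coord_prime F \<or> f \<in> coord_prime F"
    using mono_span_cancel[OF stable_outside_support, of u f F]
    unfolding coord_prime_def by (auto simp: mpoly_ring_simps)
qed (rule coord_prime_ideal mpoly_cring)+

text \<open>The set \<open>F\<close> is recovered from the variables that the ideal contains.\<close>

lemma coord_prime_inj:
  assumes "(coord_prime F :: ('n::finite, 'k::field) mpoly set) = coord_prime G"
  shows "F = G"
proof -
  have var: "Poly_Mapping.single (Poly_Mapping.single i 1) 1 \<in> (coord_prime H :: ('n, 'k) mpoly set) \<longleftrightarrow> i \<notin> H"
    for i and H :: "'n set"
    by (auto simp: coord_prime_def lookup_single when_def)
  show ?thesis using var assms by blast
qed

lemma mc_ideal_eq:
  fixes \<Gamma> :: "('n::finite \<Rightarrow> enat) set"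
  shows "(mc_ideal \<Gamma> :: ('n, 'k::field) mpoly set)
    = mono_span {a. (\<lambda>i. enat (Poly_Mapping.lookup a i)) \<notin> \<Gamma>}"
proof -
  interpret Modules.module "\<lambda>c (f :: ('n, 'k) mpoly). Poly_Mapping.single 0 c * f"
    by unfold_locales
      (simp_all add: algebra_simps single_add mult_single mult.assoc[symmetric])
  let ?D = "{a. (\<lambda>i. enat (Poly_Mapping.lookup a i)) \<notin> \<Gamma>}"
  let ?B = "{Poly_Mapping.single a (1::'k) | a. (\<lambda>i. enat (Poly_Mapping.lookup a i)) \<notin> \<Gamma>}"
  have "span ?B \<subseteq> mono_span ?D"
  proof (rule span_minimal)
    show "subspace (mono_span ?D)"
    proof (rule subspaceI)
      fix c and f :: "('n, 'k) mpoly" assume "f \<in> mono_span ?D"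
      then show "Poly_Mapping.single 0 c * f \<in> mono_span ?D"
        using keys_mult[of "Poly_Mapping.single 0 c" f] by (auto simp: mono_span_def split: if_splits)
    qed (auto simp: mono_span_add)
  qed auto
  moreover have "f \<in> span ?B" if "f \<in> mono_span ?D" for f
  proof -
    have "f = (\<Sum>a\<in>Poly_Mapping.keys f. Poly_Mapping.single 0 (Poly_Mapping.lookup f a) * Poly_Mapping.single a 1)"
      by (rule poly_mapping_eqI) (auto simp: mult_single lookup_sum lookup_single when_def in_keys_iff)
    moreover have "\<dots> \<in> span ?B"
      by (intro span_sum span_scale span_base) (use that in \<open>auto simp: mono_span_def\<close>)
    ultimately show ?thesis by simp
  qed
  ultimately show ?thesis unfolding mc_ideal_def by blast
qed


section \<open>Quotients of the polynomial ring\<close>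

lemma quot_module_module:
  assumes "ideal I R" "cring R"
  shows "module R (quot_module R I)"
proof -
  interpret ideal I R by fact
  interpret cring R by fact
  interpret Q: cring "R Quot I" by (rule quotient_is_cring) (rule assms(2))
  note hom = rcos_ring_hom
  note car = ring_hom_closed[OF hom]
  show ?thesis
  proof (rule moduleI)
    show "abelian_group (quot_module R I)"
    proof (rule abelian_groupI)
      fix x assume "x \<in> carrier (quot_module R I)"
      then show "\<exists>y\<in>carrier (quot_module R I). y \<oplus>\<^bsub>quot_module R I\<^esub> x = \<zero>\<^bsub>quot_module R I\<^esub>"
        using Q.l_neg by (auto simp: quot_module_def intro!: bexI[of _ "\<ominus>\<^bsub>R Quot I\<^esub> x"])
    qed (simp_all add: quot_module_def Q.a_assoc, rule Q.a_comm)
  qed (auto simp: quot_module_def car ring_hom_mult[OF hom] ring_hom_add[OF hom] ring_hom_one[OF hom]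
      Q.l_distr Q.r_distr Q.m_assoc assms(2))
qed

lemma quot_module_simps:
  assumes "ideal I R" "cring R"
  shows "carrier (quot_module R I) = (\<lambda>f. I +>\<^bsub>R\<^esub> f) ` carrier R"
    and "\<zero>\<^bsub>quot_module R I\<^esub> = I"
    and "f \<in> carrier R \<Longrightarrow> g \<in> carrier R \<Longrightarrow>
      (I +>\<^bsub>R\<^esub> f) \<oplus>\<^bsub>quot_module R I\<^esub> (I +>\<^bsub>R\<^esub> g) = I +>\<^bsub>R\<^esub> (f \<oplus>\<^bsub>R\<^esub> g)"
    and "f \<in> carrier R \<Longrightarrow> g \<in> carrier R \<Longrightarrow>
      f \<odot>\<^bsub>quot_module R I\<^esub> (I +>\<^bsub>R\<^esub> g) = I +>\<^bsub>R\<^esub> (f \<otimes>\<^bsub>R\<^esub> g)"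
proof -
  interpret ideal I R by fact
  interpret cring R by fact
  show "carrier (quot_module R I) = (\<lambda>f. I +>\<^bsub>R\<^esub> f) ` carrier R"
    by (auto simp: quot_module_def FactRing_simps)
  show "\<zero>\<^bsub>quot_module R I\<^esub> = I"
    by (simp add: quot_module_def FactRing_def)
  show "f \<in> carrier R \<Longrightarrow> g \<in> carrier R \<Longrightarrow>
      (I +>\<^bsub>R\<^esub> f) \<oplus>\<^bsub>quot_module R I\<^esub> (I +>\<^bsub>R\<^esub> g) = I +>\<^bsub>R\<^esub> (f \<oplus>\<^bsub>R\<^esub> g)"
    by (simp add: quot_module_def ring_hom_add[OF rcos_ring_hom])
  show "f \<in> carrier R \<Longrightarrow> g \<in> carrier R \<Longrightarrow>
      f \<odot>\<^bsub>quot_module R I\<^esub> (I +>\<^bsub>R\<^esub> g) = I +>\<^bsub>R\<^esub> (f \<otimes>\<^bsub>R\<^esub> g)"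
    by (simp add: quot_module_def ring_hom_mult[OF rcos_ring_hom])
qed

lemma mpoly_quot_simps:
  fixes I :: "('n::finite, 'k::field) mpoly set"
  assumes I: "ideal I mpoly_ring"
  shows "carrier (quot_module mpoly_ring I) = range (\<lambda>f. I +>\<^bsub>mpoly_ring\<^esub> f)"
    and "\<zero>\<^bsub>quot_module mpoly_ring I\<^esub> = I"
    and "(I +>\<^bsub>mpoly_ring\<^esub> f) \<oplus>\<^bsub>quot_module mpoly_ring I\<^esub> (I +>\<^bsub>mpoly_ring\<^esub> g) = I +>\<^bsub>mpoly_ring\<^esub> (f + g)"
    and "f \<odot>\<^bsub>quot_module mpoly_ring I\<^esub> (I +>\<^bsub>mpoly_ring\<^esub> g) = I +>\<^bsub>mpoly_ring\<^esub> (f * g)"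
  using quot_module_simps[OF I mpoly_cring] by (simp_all add: mpoly_ring_simps)

lemma mpoly_coset_eq_iff:
  fixes I :: "('n::finite, 'k::field) mpoly set"
  assumes I: "ideal I mpoly_ring"
  shows "I +>\<^bsub>mpoly_ring\<^esub> f = I +>\<^bsub>mpoly_ring\<^esub> g \<longleftrightarrow> f - g \<in> I"
  using ring.quotient_eq_iff_same_a_r_cos[OF cring.axioms(1)[OF mpoly_cring] I, of f g]
  by (simp add: mpoly_ring_simps a_minus_def mpoly_uminus)

lemma mpoly_coset_zero: "I +>\<^bsub>mpoly_ring\<^esub> (0 :: ('n::finite, 'k::field) mpoly) = I"
  by (auto simp: a_r_coset_def r_coset_def mpoly_ring_simps)

lemma mpoly_coset_eq_self_iff:
  fixes I :: "('n::finite, 'k::field) mpoly set"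
  assumes I: "ideal I mpoly_ring"
  shows "I +>\<^bsub>mpoly_ring\<^esub> f = I \<longleftrightarrow> f \<in> I"
  using mpoly_coset_eq_iff[OF I, of f 0] by (simp add: mpoly_coset_zero)

definition coset_span :: "('n::finite, 'k::field) mpoly set \<Rightarrow> ('n \<Rightarrow>\<^sub>0 nat) set \<Rightarrow> ('n, 'k) mpoly set set" where
  "coset_span I D = (\<lambda>f. I +>\<^bsub>mpoly_ring\<^esub> f) ` mono_span D"

lemma coset_mem_coset_span_iff:
  assumes I: "ideal I mpoly_ring" and "I \<subseteq> mono_span D"
  shows "I +>\<^bsub>mpoly_ring\<^esub> f \<in> coset_span I D \<longleftrightarrow> f \<in> mono_span D"
proof
  assume "I +>\<^bsub>mpoly_ring\<^esub> f \<in> coset_span I D"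
  then obtain g where g: "g \<in> mono_span D" "f - g \<in> I"
    unfolding coset_span_def using mpoly_coset_eq_iff[OF I] by blast
  then show "f \<in> mono_span D"
    using mono_span_add[of "f - g" D g] assms(2) by auto
qed (simp add: coset_span_def)

lemma coset_span_submodule:
  fixes I :: "('n::finite, 'k::field) mpoly set"
  assumes I: "ideal I mpoly_ring" and D: "\<And>a b. b \<in> D \<Longrightarrow> a + b \<in> D"
  shows "submodule (coset_span I D) mpoly_ring (quot_module mpoly_ring I)"
proof -
  interpret module "mpoly_ring :: ('n, 'k) mpoly ring" "quot_module mpoly_ring I"
    by (rule quot_module_module[OF I mpoly_cring])
  note simps = mpoly_quot_simps[OF I]
  have neg: "\<ominus>\<^bsub>quot_module mpoly_ring I\<^esub> (I +>\<^bsub>mpoly_ring\<^esub> f) = I +>\<^bsub>mpoly_ring\<^esub> (- f)" for f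
    by (rule M.minus_equality) (auto simp: simps mpoly_coset_zero)
  show ?thesis
  proof (rule submoduleI)
    show "\<zero>\<^bsub>quot_module mpoly_ring I\<^esub> \<in> coset_span I D"
      unfolding coset_span_def simps
      by (rule image_eqI[of _ _ 0]) (simp_all add: mpoly_coset_zero)
  qed (auto simp: coset_span_def simps neg mono_span_uminus mono_span_add mono_span_mult[OF D])
qed

section \<open>Local multiplicities\<close>

text \<open>The largest power of \<open>coord_prime F\<close> containing \<open>x\<^sup>a\<close> is the one with this exponent.\<close>

definition outer_degree :: "'n::finite set \<Rightarrow> ('n \<Rightarrow>\<^sub>0 nat) \<Rightarrow> nat" where
  "outer_degree F a = (\<Sum>i\<in>-F. Poly_Mapping.lookup a i)"

lemma outer_degree_add: "outer_degree F (a + b) = outer_degree F a + outer_degree F b"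
  by (simp add: outer_degree_def lookup_add sum.distrib)

lemma coord_prime_power_sub:
  fixes q :: "('n::finite, 'k::field) mpoly"
  assumes "q \<in> coord_prime F [^]\<^bsub>ideals_set mpoly_ring\<^esub> (k::nat)"
  shows "q \<in> mono_span {a. k \<le> outer_degree F a}"
  using assms
proof (induction k arbitrary: q)
  case 0
  then show ?case by (simp add: mono_span_def)
next
  case (Suc k)
  from Suc.prems show ?case
    unfolding ideal_power_Suc
  proof (induction q rule: ideal_prod.induct)
    case (prod i j)
    have "Suc k \<le> outer_degree F (a + b)"
      if a: "a \<in> Poly_Mapping.keys i" and b: "b \<in> Poly_Mapping.keys j" for a b
    proof -
      have "k \<le> outer_degree F a"
        using Suc.IH[OF prod(1)] a by (auto simp: mono_span_def)
      moreover obtain l where "l \<notin> F" "Poly_Mapping.lookup b l \<noteq> 0"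
        using prod(2) b by (auto simp: coord_prime_def mono_span_def)
      then have "outer_degree F b \<noteq> 0"
        unfolding outer_degree_def by auto
      ultimately show ?thesis unfolding outer_degree_add by simp
    qed
    then show ?case
      using keys_mult[of i j] by (fastforce simp: mono_span_def mpoly_ring_simps)
  next
    case (sum f g)
    then show ?case by (simp add: mpoly_ring_simps mono_span_add)
  qed
qed

lemma variable_power_mem_coord_prime_power:
  assumes "i \<notin> F"
  shows "(Poly_Mapping.single (Poly_Mapping.single i k) 1 :: ('n::finite, 'k::field) mpoly)
    \<in> coord_prime F [^]\<^bsub>ideals_set mpoly_ring\<^esub> (k::nat)"
proof (induction k)
  case 0
  then show ?case unfolding ideal_power_0 by (simp add: mpoly_ring_simps)
next
  case (Suc k)
  have "(Poly_Mapping.single (Poly_Mapping.single i 1) 1 :: ('n, 'k) mpoly) \<in> coord_prime F"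
    using assms by (auto simp: coord_prime_def lookup_single)
  from ideal_prod.prod[OF Suc this, where R = mpoly_ring]
  show ?case unfolding ideal_power_Suc
    by (simp add: mpoly_ring_simps mult_single single_add[symmetric])
qed

text \<open>Provides the order in which the facets are added to the filtration.\<close>

lemma ex_descending_list:
  fixes d :: "'a \<Rightarrow> nat"
  assumes "finite T"
  obtains cs where "set cs = T" "distinct cs"
    "\<And>i k. i \<le> k \<Longrightarrow> k < length cs \<Longrightarrow> d (cs ! k) \<le> d (cs ! i)"
proof -
  obtain xs where xs: "set xs = T" "distinct xs"
    using finite_distinct_list[OF assms] by blast
  let ?ys = "sort_key d xs"
  show thesis
  proof
    show "set (rev ?ys) = T" "distinct (rev ?ys)" using xs by auto
    fix i k assume ik: "i \<le> k" "k < length (rev ?ys)"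
    have "sorted (map d ?ys)" by simp
    then have "map d ?ys ! (length ?ys - Suc k) \<le> map d ?ys ! (length ?ys - Suc i)"
      by (rule sorted_nth_mono) (use ik in auto)
    then show "d (rev ?ys ! k) \<le> d (rev ?ys ! i)"
      using ik by (simp add: rev_nth)
  qed
qed

text \<open>Monomials that, after inverting the variables in \<open>F\<close>, vanish modulo the ideal of \<open>\<Gamma>\<close> or become
  one of the monomials listed in \<open>T\<close>.\<close>

definition face_exponents :: "('n \<Rightarrow> enat) set \<Rightarrow> 'n set \<Rightarrow> ('n \<Rightarrow> enat) set \<Rightarrow> ('n \<Rightarrow>\<^sub>0 nat) set" where
  "face_exponents \<Gamma> F T = {b. infty_on F b \<notin> \<Gamma> \<or> infty_on F b \<in> T}"

definition facets_at :: "('n \<Rightarrow> enat) set \<Rightarrow> 'n set \<Rightarrow> ('n \<Rightarrow> enat) set" where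
  "facets_at \<Gamma> F = {a \<in> facets \<Gamma>. infpt a = F}"

lemma infty_on_empty_le: "infty_on {} b \<le> infty_on F b"
  by (simp add: le_fun_def infty_on_def)

lemma mc_ideal_eq_infty_on: "mc_ideal \<Gamma> = mono_span {a. infty_on {} a \<notin> \<Gamma>}"
  unfolding mc_ideal_eq infty_on_empty ..

lemma mc_ideal_ideal:
  assumes "multicomplex \<Gamma>"
  shows "ideal (mc_ideal \<Gamma> :: ('n::finite, 'k::field) mpoly set) mpoly_ring"
  unfolding mc_ideal_eq_infty_on
proof (rule mono_span_ideal, clarsimp)
  fix a b :: "'n \<Rightarrow>\<^sub>0 nat" assume "infty_on {} b \<notin> \<Gamma>" "infty_on {} (a + b) \<in> \<Gamma>"
  moreover have "infty_on {} b \<le> infty_on {} (a + b)"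
    by (simp add: infty_on_le_iff lookup_add)
  ultimately show False using multicomplex_downward[OF assms] by blast
qed

lemma mc_ideal_sub_face:
  assumes "multicomplex \<Gamma>"
  shows "mc_ideal \<Gamma> \<subseteq> mono_span (face_exponents \<Gamma> F T)"
proof -
  have "{a. infty_on {} a \<notin> \<Gamma>} \<subseteq> face_exponents \<Gamma> F T"
    using multicomplex_downward[OF assms _ infty_on_empty_le] unfolding face_exponents_def by blast
  then show ?thesis unfolding mc_ideal_eq_infty_on using mono_span_mono by blast
qed

text \<open>The part of \<open>f\<close> whose exponents agree with \<open>c\<close> outside \<open>F\<close> is a monomial in the variables outside
  \<open>F\<close> times a polynomial in the variables of \<open>F\<close>.  The latter is a unit after localizing, unless it is
  zero; this makes the steps of the filtration simple.\<close>

lemma split_off_monomial: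
  fixes f :: "('n::finite, 'k::field) mpoly"
  obtains f0 where "Poly_Mapping.keys f0 \<subseteq> {a. \<forall>i. i \<notin> F \<longrightarrow> Poly_Mapping.lookup a i = 0}"
    "Poly_Mapping.keys (f - f0 * Poly_Mapping.single (exponent (\<lambda>i. if i \<in> F then 0 else the_enat (c i))) 1)
      \<subseteq> {a \<in> Poly_Mapping.keys f. infty_on F a \<noteq> c}"
proof -
  define K where "K = {a \<in> Poly_Mapping.keys f. infty_on F a = c}"
  define res where "res a = exponent (\<lambda>i. if i \<in> F then Poly_Mapping.lookup a i else 0)" for a :: "'n \<Rightarrow>\<^sub>0 nat"
  define c0 where "c0 = exponent (\<lambda>i. if i \<in> F then 0 else the_enat (c i))"
  define f0 where "f0 = (\<Sum>a\<in>K. Poly_Mapping.single (res a) (Poly_Mapping.lookup f a))"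
  have "res a + c0 = a" if "a \<in> K" for a
  proof (rule poly_mapping_eqI)
    fix i
    have "infty_on F a i = c i" using that by (auto simp: K_def)
    then show "Poly_Mapping.lookup (res a + c0) i = Poly_Mapping.lookup a i"
      by (cases "i \<in> F") (auto simp: res_def c0_def lookup_add infty_on_def split: if_splits dest: sym)
  qed
  then have f0c: "f0 * Poly_Mapping.single c0 1 = (\<Sum>a\<in>K. Poly_Mapping.single a (Poly_Mapping.lookup f a))"
    unfolding f0_def sum_distrib_right by (intro sum.cong) (simp_all add: mult_single)
  have "Poly_Mapping.lookup (f - f0 * Poly_Mapping.single c0 1) a
      = (if a \<in> K then 0 else Poly_Mapping.lookup f a)" for a
  proof -
    have "finite K" by (simp add: K_def)
    then show ?thesis
      unfolding f0c by (simp add: lookup_minus lookup_sum lookup_single when_def)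
  qed
  then have "Poly_Mapping.keys (f - f0 * Poly_Mapping.single c0 1) \<subseteq> {a \<in> Poly_Mapping.keys f. infty_on F a \<noteq> c}"
    by (auto simp: in_keys_iff K_def split: if_splits)
  moreover have "Poly_Mapping.keys f0 \<subseteq> {a. \<forall>i. i \<notin> F \<longrightarrow> Poly_Mapping.lookup a i = 0}"
  proof -
    have "f0 \<in> mono_span {a. \<forall>i. i \<notin> F \<longrightarrow> Poly_Mapping.lookup a i = 0}"
      unfolding f0_def
    proof (induction K rule: infinite_finite_induct)
      case (insert a K)
      have "Poly_Mapping.single (res a) (Poly_Mapping.lookup f a)
          \<in> mono_span {a. \<forall>i. i \<notin> F \<longrightarrow> Poly_Mapping.lookup a i = 0}"
        by (simp add: mono_span_def res_def)
      then show ?case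
        using insert by (simp add: mono_span_add)
    qed simp_all
    then show ?thesis by (simp add: mono_span_def)
  qed
  ultimately show thesis using that unfolding c0_def by blast
qed

text \<open>The filtration lives in \<open>S/I\<close>: its member \<open>N j\<close> is spanned by the monomials that vanish after localizing
  together with those that become one of the first \<open>j\<close> facets in a list of decreasing degree.\<close>

lemma local_mult_eq_card_facets:
  fixes \<Gamma> :: "('n::finite \<Rightarrow> enat) set"
  assumes mc: "multicomplex \<Gamma>"
  shows "local_mult mpoly_ring (quot_module mpoly_ring (mc_ideal \<Gamma> :: ('n, 'k::field) mpoly set)) (coord_prime F)
    = enat (card (facets_at \<Gamma> F))"
proof -
  define I where "I = (mc_ideal \<Gamma> :: ('n, 'k) mpoly set)"
  define M where "M = quot_module mpoly_ring I"
  define P where "P = (coord_prime F :: ('n, 'k) mpoly set)"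
  have I: "ideal I mpoly_ring" unfolding I_def by (rule mc_ideal_ideal[OF mc])
  interpret localization mpoly_ring M P
    unfolding M_def P_def
    by (intro localization.intro quot_module_module[OF I mpoly_cring] coord_prime_prime)
  note Msimps = mpoly_quot_simps[OF I, folded M_def]
  have denoms: "u \<in> denoms \<longleftrightarrow> u \<notin> coord_prime F" for u
    by (simp add: P_def mpoly_ring_simps)
  define d where "d c = (\<Sum>i\<in>-F. the_enat (c i))" for c :: "'n \<Rightarrow> enat"
  have d_infty_on: "d (infty_on F b) = outer_degree F b" for b
    by (auto simp: d_def outer_degree_def infty_on_def intro: sum.cong)
  have "finite (facets_at \<Gamma> F)" using finite_facets[OF mc] by (simp add: facets_at_def)
  then obtain cs :: "('n \<Rightarrow> enat) list" where cs: "set cs = facets_at \<Gamma> F" "distinct cs"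
    and desc: "\<And>i k. i \<le> k \<Longrightarrow> k < length cs \<Longrightarrow> d (cs ! k) \<le> d (cs ! i)"
    using ex_descending_list[of "facets_at \<Gamma> F" d] by blast
  define n where "n = length cs"
  have n: "n = card (facets_at \<Gamma> F)" unfolding n_def cs(1)[symmetric] using distinct_card[OF cs(2)] by simp
  define D where "D j = face_exponents \<Gamma> F (set (take j cs))" for j
  define N where "N j = coset_span I (D j)" for j
  have above_facet: "infty_on F b \<in> facets_at \<Gamma> F"
    if "a \<in> facets_at \<Gamma> F" "a \<le> infty_on F b" "infty_on F b \<in> \<Gamma>" for a b
  proof -
    have "infpt c = F" if "c \<in> \<Gamma>" "infty_on F b \<le> c" for c
      using that \<open>a \<in> facets_at \<Gamma> F\<close> \<open>a \<le> infty_on F b\<close> facet_iff[OF mc, of a] order_trans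
      unfolding facets_at_def by blast
    then show ?thesis
      using that facet_iff[OF mc, of "infty_on F b"] unfolding facets_at_def by simp
  qed
  have stable: "stable_outside F (D j)" if "j \<le> n" for j
    unfolding stable_outside_def
  proof (intro ballI allI impI)
    fix a b assume a: "a \<in> D j" and ab: "\<forall>i. i \<notin> F \<longrightarrow> Poly_Mapping.lookup a i \<le> Poly_Mapping.lookup b i"
    then have le: "infty_on F a \<le> infty_on F b" by (simp add: infty_on_le_iff)
    show "b \<in> D j"
    proof (cases "infty_on F b \<in> \<Gamma>")
      case True
      then have "infty_on F a \<in> \<Gamma>" using multicomplex_downward[OF mc] le by blast
      then have "infty_on F a \<in> set (take j cs)" using a by (simp add: D_def face_exponents_def)
      then obtain i where i: "i < j" "i < length cs" "infty_on F a = cs ! i"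
        by (auto simp: in_set_conv_nth)
      have "infty_on F b \<in> set cs"
        unfolding cs(1) using above_facet[OF _ le True] i(2,3) cs(1) nth_mem by metis
      then obtain k where k: "k < length cs" "infty_on F b = cs ! k"
        by (auto simp: in_set_conv_nth)
      \<comment> \<open>The other facets above a facet have larger degree, so they come earlier in the list.\<close>
      have "k < j"
      proof (rule ccontr)
        assume "\<not> k < j"
        then have "outer_degree F b \<le> outer_degree F a"
          unfolding d_infty_on[symmetric] i(3) k(2) using desc[of i k] i(1) k(1) by simp
        moreover have "outer_degree F a \<le> outer_degree F b"
          unfolding outer_degree_def using ab by (intro sum_mono) auto
        ultimately have "outer_degree F a = outer_degree F b" by simp
        then have "Poly_Mapping.lookup a i = Poly_Mapping.lookup b i" if "i \<notin> F" for i
          unfolding outer_degree_def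
          using sum_mono_inv[of "Poly_Mapping.lookup a" "-F" "Poly_Mapping.lookup b" i] that ab by auto
        then have "cs ! i = cs ! k" using i k infty_on_eq_iff by metis
        then have "i = k" using nth_eq_iff_index_eq[OF cs(2)] i k by simp
        then show False using i(1) \<open>\<not> k < j\<close> by simp
      qed
      then show ?thesis
        using k by (auto simp: D_def face_exponents_def in_set_conv_nth)
    qed (simp add: D_def face_exponents_def)
  qed
  have ID: "I \<subseteq> mono_span (D j)" for j
    unfolding I_def D_def by (rule mc_ideal_sub_face[OF mc])
  have mem: "I +>\<^bsub>mpoly_ring\<^esub> f \<in> N j \<longleftrightarrow> f \<in> mono_span (D j)" for f j
    unfolding N_def by (rule coset_mem_coset_span_iff[OF I ID])
  have DSuc: "D (Suc j) = D j \<union> {b. infty_on F b = cs ! j}" if "j < n" for j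
    using that by (auto simp: D_def face_exponents_def take_Suc_conv_app_nth n_def)
  have D0: "D 0 = {b. infty_on F b \<notin> \<Gamma>}" by (simp add: D_def face_exponents_def)
  have Dn: "D n = {b. infty_on F b \<notin> \<Gamma> \<or> infty_on F b \<in> facets_at \<Gamma> F}"
    by (simp add: D_def face_exponents_def n_def cs(1))
  have "local_mult mpoly_ring M P = enat n"
  proof (rule local_mult_filtration)
    show "submodule (N j) mpoly_ring M" if "j \<le> n" for j
      unfolding N_def M_def
      by (rule coset_span_submodule[OF I stable_outside_add[OF stable[OF that]]])
  next
    fix j u m assume j: "j \<le> n" and u: "u \<in> denoms" and m: "m \<in> carrier M" and um: "u \<odot>\<^bsub>M\<^esub> m \<in> N j"
    obtain f where f: "m = I +>\<^bsub>mpoly_ring\<^esub> f" using m by (auto simp: Msimps)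
    have "u * f \<in> mono_span (D j)" using um mem by (simp add: f Msimps)
    then show "m \<in> N j"
      unfolding f mem using mono_span_cancel[OF stable[OF j]] u denoms by blast
  next
    fix m assume "m \<in> N 0"
    then obtain f where f: "m = I +>\<^bsub>mpoly_ring\<^esub> f" "f \<in> mono_span (D 0)"
      by (auto simp: N_def coset_span_def)
    have "\<exists>N0. \<forall>N\<ge>N0. infty_on {} (block F N + b) \<notin> \<Gamma>" if "b \<in> Poly_Mapping.keys f" for b
    proof -
      have "infty_on F b \<notin> \<Gamma>" using that f(2) by (auto simp: D0 mono_span_def)
      then show ?thesis
        using infty_on_limit[OF mc, of F b] by metis
    qed
    then obtain N0 where N0: "\<And>b N. b \<in> Poly_Mapping.keys f \<Longrightarrow> N0 b \<le> N \<Longrightarrow> infty_on {} (block F N + b) \<notin> \<Gamma>"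
      by metis
    define N1 where "N1 = (\<Sum>b\<in>Poly_Mapping.keys f. N0 b)"
    \<comment> \<open>A monomial in the variables of \<open>F\<close>, hence a denominator, large enough for all exponents of \<open>f\<close> at once.\<close>
    define u where "u = (Poly_Mapping.single (block F N1) 1 :: ('n, 'k) mpoly)"
    have "infty_on {} (block F N1 + b) \<notin> \<Gamma>" if "b \<in> Poly_Mapping.keys f" for b
      using N0[OF that] member_le_sum[OF that, of N0] by (simp add: N1_def)
    then have "u * f \<in> I"
      unfolding I_def mc_ideal_eq_infty_on u_def single_mult_mem_mono_span by simp
    then have "u \<odot>\<^bsub>M\<^esub> m = \<zero>\<^bsub>M\<^esub>"
      by (simp add: f Msimps mpoly_coset_eq_self_iff[OF I])
    moreover have "u \<in> denoms"
      unfolding denoms u_def coord_prime_def by (simp add: lookup_block)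
    ultimately show "\<exists>u\<in>denoms. u \<odot>\<^bsub>M\<^esub> m = \<zero>\<^bsub>M\<^esub>" by blast
  next
    fix m assume "m \<in> carrier M"
    then obtain f where f: "m = I +>\<^bsub>mpoly_ring\<^esub> f" by (auto simp: Msimps)
    have "f \<in> mono_span (D n) \<longleftrightarrow>
        (\<exists>k::nat. \<forall>q\<in>P [^]\<^bsub>ideals_set mpoly_ring\<^esub> k. q * f \<in> mono_span (D 0))"
    proof
      assume fD: "f \<in> mono_span (D n)"
      \<comment> \<open>Larger than the degree of every facet, so multiplication by \<open>P\<^sup>k\<close> pushes each facet out of \<open>\<Gamma>\<close>.\<close>
      define k where "k = Suc (\<Sum>c\<in>facets_at \<Gamma> F. d c)"
      have "q * f \<in> mono_span (D 0)" if q: "q \<in> P [^]\<^bsub>ideals_set mpoly_ring\<^esub> k" for q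
      proof -
        have "a + b \<in> D 0" if "a \<in> Poly_Mapping.keys q" "b \<in> Poly_Mapping.keys f" for a b
        proof -
          have "k \<le> outer_degree F a"
            using coord_prime_power_sub[OF q[unfolded P_def]] that(1) by (auto simp: mono_span_def)
          then have k: "k \<le> d (infty_on F (a + b))"
            by (simp add: d_infty_on outer_degree_add)
          have "infty_on F (a + b) \<notin> facets_at \<Gamma> F"
          proof
            assume "infty_on F (a + b) \<in> facets_at \<Gamma> F"
            then have "d (infty_on F (a + b)) \<le> (\<Sum>c\<in>facets_at \<Gamma> F. d c)"
              using \<open>finite (facets_at \<Gamma> F)\<close> by (intro member_le_sum) auto
            then show False using k by (simp add: k_def)
          qed
          moreover have "a + b \<in> D n"
            using stable_outside_add[OF stable[OF order_refl]] that(2) fD by (auto simp: mono_span_def)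
          ultimately show ?thesis by (simp add: Dn D0)
        qed
        then show ?thesis using keys_mult[of q f] unfolding mono_span_def by blast
      qed
      then show "\<exists>k::nat. \<forall>q\<in>P [^]\<^bsub>ideals_set mpoly_ring\<^esub> k. q * f \<in> mono_span (D 0)" by blast
    next
      assume "\<exists>k::nat. \<forall>q\<in>P [^]\<^bsub>ideals_set mpoly_ring\<^esub> k. q * f \<in> mono_span (D 0)"
      then obtain k :: nat where k: "\<And>q. q \<in> P [^]\<^bsub>ideals_set mpoly_ring\<^esub> k \<Longrightarrow> q * f \<in> mono_span (D 0)"
        by blast
      have "infty_on F b \<in> facets_at \<Gamma> F" if b: "b \<in> Poly_Mapping.keys f" and bG: "infty_on F b \<in> \<Gamma>" for b
      proof -
        have "infpt c = F" if c: "c \<in> \<Gamma>" "infty_on F b \<le> c" for c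
        proof (rule ccontr)
          assume "infpt c \<noteq> F"
          then obtain i where i: "i \<in> infpt c" "i \<notin> F"
            using infpt_mono[OF c(2)] by auto
          have "infty_on F (Poly_Mapping.single i k + b) \<notin> \<Gamma>"
            using k[unfolded P_def, OF variable_power_mem_coord_prime_power[OF i(2)]] b
            unfolding single_mult_mem_mono_span D0 by blast
          moreover have "infty_on F (Poly_Mapping.single i k + b) \<le> c"
            unfolding le_fun_def
          proof
            fix l
            show "infty_on F (Poly_Mapping.single i k + b) l \<le> c l"
              using i le_funD[OF c(2), of l]
              by (cases "l = i") (auto simp: infpt_def infty_on_def lookup_add lookup_single)
          qed
          ultimately show False using multicomplex_downward[OF mc c(1)] by blast
        qed
        then show ?thesis
          using bG facet_iff[OF mc, of "infty_on F b"] unfolding facets_at_def by simp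
      qed
      then show "f \<in> mono_span (D n)" unfolding Dn mono_span_def by blast
    qed
    then show "m \<in> N n \<longleftrightarrow> (\<exists>k::nat. \<forall>q\<in>P [^]\<^bsub>ideals_set mpoly_ring\<^esub> k. q \<odot>\<^bsub>M\<^esub> m \<in> N 0)"
      by (simp add: f Msimps mem)
  next
    fix j assume j: "j < n"
    obtain b where b: "cs ! j = infty_on F b"
    proof -
      have "infpt (cs ! j) = F"
        using j cs(1) nth_mem[of j cs] by (auto simp: n_def facets_at_def)
      then show thesis using that infty_on_cases[of "cs ! j"] by metis
    qed
    have "infty_on F b \<in> \<Gamma>"
      using j cs(1) nth_mem[of j cs] b facets_mem by (auto simp: n_def facets_at_def)
    moreover have "infty_on F b \<notin> set (take j cs)"
      using cs(2) j unfolding b[symmetric] in_set_conv_nth n_def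
      by (auto simp: nth_eq_iff_index_eq)
    ultimately have "b \<notin> D j" by (simp add: D_def face_exponents_def)
    then have "I +>\<^bsub>mpoly_ring\<^esub> Poly_Mapping.single b 1 \<in> N (Suc j) - N j"
      by (simp add: mem DSuc[OF j] b)
    moreover have "N j \<subseteq> N (Suc j)"
      unfolding N_def coset_span_def DSuc[OF j] using mono_span_mono[of "D j"] by blast
    ultimately show "N j \<subset> N (Suc j)" by blast
  next
    fix j x y assume j: "j < n" and x: "x \<in> N (Suc j)" and y: "y \<in> N (Suc j) - N j"
    obtain f where f: "x = I +>\<^bsub>mpoly_ring\<^esub> f" "f \<in> mono_span (D (Suc j))"
      using x by (auto simp: N_def coset_span_def)
    obtain g where g: "y = I +>\<^bsub>mpoly_ring\<^esub> g" "g \<in> mono_span (D (Suc j))"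
      using y by (auto simp: N_def coset_span_def)
    have gn: "g \<notin> mono_span (D j)" using y mem by (simp add: g)
    define xc where "xc = (Poly_Mapping.single (exponent (\<lambda>i. if i \<in> F then 0 else the_enat ((cs ! j) i))) 1 :: ('n, 'k) mpoly)"
    have split: "\<exists>h0. Poly_Mapping.keys h0 \<subseteq> {a. \<forall>i. i \<notin> F \<longrightarrow> Poly_Mapping.lookup a i = 0}
        \<and> h - h0 * xc \<in> mono_span (D j)" if h: "h \<in> mono_span (D (Suc j))" for h :: "('n, 'k) mpoly"
    proof -
      obtain h0 where h0: "Poly_Mapping.keys h0 \<subseteq> {a. \<forall>i. i \<notin> F \<longrightarrow> Poly_Mapping.lookup a i = 0}"
        "Poly_Mapping.keys (h - h0 * xc) \<subseteq> {a \<in> Poly_Mapping.keys h. infty_on F a \<noteq> cs ! j}"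
        unfolding xc_def by (rule split_off_monomial)
      have "h - h0 * xc \<in> mono_span (D j)"
        using h0(2) h unfolding mono_span_def DSuc[OF j] by blast
      with h0(1) show ?thesis by blast
    qed
    obtain f0 where f0: "f - f0 * xc \<in> mono_span (D j)"
      using split[OF f(2)] by blast
    obtain g0 where "Poly_Mapping.keys g0 \<subseteq> {a. \<forall>i. i \<notin> F \<longrightarrow> Poly_Mapping.lookup a i = 0}
        \<and> g - g0 * xc \<in> mono_span (D j)"
      using split[OF g(2)] ..
    note g0 = conjunct1[OF this] conjunct2[OF this]
    have "g0 \<notin> coord_prime F"
    proof
      assume "g0 \<in> coord_prime F"
      then have "a \<notin> Poly_Mapping.keys g0" for a
        using subsetD[OF g0(1), of a] by (auto simp: coord_prime_def mono_span_def)
      then have "Poly_Mapping.keys g0 = {}" by blast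
      then have "g0 = 0" by (simp add: keys_eq_empty)
      then show False using g0(2) gn by simp
    qed
    \<comment> \<open>The monomial \<open>xc\<close> of the facet \<open>cs ! j\<close> cancels from this cross product.\<close>
    moreover have "g0 * f - f0 * g \<in> mono_span (D j)"
    proof -
      have "g0 * f - f0 * g = g0 * (f - f0 * xc) - f0 * (g - g0 * xc)"
        by (simp add: algebra_simps)
      then show ?thesis
        using f0 g0(2) stable_outside_add[OF stable[of j]] j
        by (auto intro!: mono_span_diff mono_span_mult)
    qed
    moreover have "g0 \<odot>\<^bsub>M\<^esub> x = (I +>\<^bsub>mpoly_ring\<^esub> (g0 * f - f0 * g)) \<oplus>\<^bsub>M\<^esub> f0 \<odot>\<^bsub>M\<^esub> y"
      by (simp add: f g Msimps)
    ultimately show "\<exists>t\<in>denoms. \<exists>r\<in>carrier mpoly_ring. \<exists>z\<in>N j. t \<odot>\<^bsub>M\<^esub> x = z \<oplus>\<^bsub>M\<^esub> r \<odot>\<^bsub>M\<^esub> y"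
      using denoms mem by (metis UNIV_I mpoly_ring_simps(1))
  qed
  then show ?thesis by (simp only: M_def P_def I_def n)
qed


section \<open>Degrees of coordinate primes\<close>

definition face_monomials :: "'n::finite set \<Rightarrow> nat \<Rightarrow> ('n \<Rightarrow>\<^sub>0 nat) set" where
  "face_monomials F k =
    {a. (\<forall>i. i \<notin> F \<longrightarrow> Poly_Mapping.lookup a i = 0) \<and> (\<Sum>i\<in>UNIV. Poly_Mapping.lookup a i) = k}"

lemma face_monomials_eq_image:
  "face_monomials F k = (\<lambda>A. exponent (count A)) ` multisets_of_size F k"
proof (intro antisym subsetI)
  fix a assume a: "a \<in> face_monomials F k"
  define A where "A = Abs_multiset (Poly_Mapping.lookup a)"
  have count: "count A = Poly_Mapping.lookup a"
    unfolding A_def by (simp add: Abs_multiset_inverse)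
  have sub: "set_mset A \<subseteq> F"
    using a by (auto simp: face_monomials_def set_mset_def count)
  have "size A = (\<Sum>i\<in>UNIV. Poly_Mapping.lookup a i)"
    unfolding size_multiset_overloaded_eq count[symmetric]
    by (rule sum.mono_neutral_left) (auto simp: not_in_iff)
  with sub a have "A \<in> multisets_of_size F k"
    by (simp add: multisets_of_size_def face_monomials_def)
  moreover have "a = exponent (count A)" by (rule poly_mapping_eqI) (simp add: count)
  ultimately show "a \<in> (\<lambda>A. exponent (count A)) ` multisets_of_size F k" by blast
next
  fix a assume "a \<in> (\<lambda>A. exponent (count A)) ` multisets_of_size F k"
  then obtain A where A: "a = exponent (count A)" "size A = k" "set_mset A \<subseteq> F"
    by (auto simp: multisets_of_size_def)
  have "size A = (\<Sum>i\<in>UNIV. count A i)"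
    unfolding size_multiset_overloaded_eq
    by (rule sum.mono_neutral_left) (auto simp: not_in_iff)
  then show "a \<in> face_monomials F k"
    using A by (auto simp: face_monomials_def simp flip: not_in_iff)
qed

lemma finite_face_monomials: "finite (face_monomials F k)"
  unfolding face_monomials_eq_image by (simp add: finite_multisets_of_size)

text \<open>Monomials of degree \<open>k\<close> in the variables of \<open>F\<close> are multisets of size \<open>k\<close> over \<open>F\<close>.\<close>

lemma card_face_monomials:
  fixes F :: "'n::finite set"
  shows "card (face_monomials F k) = (card F + k - 1) choose k"
proof -
  have inj: "inj (\<lambda>A. exponent (count A))"
  proof (rule injI)
    fix A B assume "exponent (count A) = exponent (count B)"
    then have "Poly_Mapping.lookup (exponent (count A)) = Poly_Mapping.lookup (exponent (count B))" by simp
    then have "count A = count B" by (simp add: fun_eq_iff)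
    then show "A = B" by (simp add: count_inject)
  qed
  have "card (face_monomials F k) = card (multisets_of_size F k)"
    unfolding face_monomials_eq_image by (rule card_image[OF inj_on_subset[OF inj subset_UNIV]])
  then show ?thesis by (simp add: card_multisets_of_size)
qed

lemma list_eq_map_distinct:
  assumes "distinct as" "length cs = length as"
  obtains g where "cs = map g as"
proof -
  have "\<exists>g. cs = map g as"
    using assms(2,1)
  proof (induction rule: list_induct2)
    case (Cons c cs a as)
    then obtain g where "cs = map g as" by auto
    then have "c # cs = map (g(a := c)) (a # as)" using Cons.prems by auto
    then show ?case by (rule exI[of _ "g(a := c)"])
  qed simp
  then show thesis using that by blast
qed

text \<open>The cosets of the monomials of degree \<open>k\<close> in the variables of \<open>F\<close> form a basis: the ideal contains
  exactly the polynomials all of whose monomials involve some other variable.\<close>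

lemma hilbert_fun_coord_prime:
  "hilbert_fun (coord_prime F :: ('n::finite, 'k::field) mpoly set) k = card (face_monomials F k)"
proof -
  define J where "J = (coord_prime F :: ('n, 'k) mpoly set)"
  define Q where "Q = mpoly_ring Quot J"
  have Jp: "primeideal J mpoly_ring" unfolding J_def by (rule coord_prime_prime)
  then have J: "ideal J mpoly_ring" by (simp add: primeideal_def)
  interpret Q: domain Q unfolding Q_def by (rule primeideal.quotient_is_domain[OF Jp])
  define cos where "cos f = J +>\<^bsub>mpoly_ring\<^esub> f" for f
  have hom: "cos \<in> ring_hom mpoly_ring Q"
    unfolding Q_def using ideal.rcos_ring_hom[OF J] by (simp add: cos_def[abs_def])
  have Qcar: "cos f \<in> carrier Q" for f
    using ring_hom_closed[OF hom, of f] by (simp add: mpoly_ring_simps)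
  have Qadd: "cos f \<oplus>\<^bsub>Q\<^esub> cos g = cos (f + g)" for f g
    using ring_hom_add[OF hom, of f g] by (simp add: mpoly_ring_simps)
  have Qmult: "cos f \<otimes>\<^bsub>Q\<^esub> cos g = cos (f * g)" for f g
    using ring_hom_mult[OF hom, of f g] by (simp add: mpoly_ring_simps)
  have Qone: "\<one>\<^bsub>Q\<^esub> = cos 1"
    using ring_hom_one[OF hom] by (simp add: mpoly_ring_simps)
  have Qzero: "\<zero>\<^bsub>Q\<^esub> = cos 0"
    by (simp add: Q_def FactRing_def cos_def mpoly_coset_zero)
  have cos_eq: "cos f = cos g \<longleftrightarrow> f - g \<in> J" for f g
    unfolding cos_def by (rule mpoly_coset_eq_iff[OF J])
  define h where "h c = cos (Poly_Mapping.single 0 c)" for c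
  have h: "h \<in> ring_hom (ring_of_type_algebra :: 'k ring) Q"
    by (rule ring_hom_memI)
      (simp_all add: ring_of_type_algebra_def h_def Qcar Qadd Qmult Qone mult_single single_add)
  have fld: "field (ring_of_type_algebra :: 'k ring)" by (rule field_from_type_algebra)
  have hr: "ring_hom_ring (ring_of_type_algebra :: 'k ring) Q h"
    by (rule ring_hom_ringI2[OF _ Q.ring_axioms h]) (rule ring_from_type_algebra)
  have K: "subfield (range h) Q"
    using ring_hom_ring.img_is_subfield(2)[OF hr field.carrier_is_subfield[OF fld] Q.one_not_zero]
    by (simp add: ring_of_type_algebra_def)
  obtain as where as: "set as = face_monomials F k" "distinct as"
    using finite_distinct_list[OF finite_face_monomials] by blast
  define x where "x a = cos (Poly_Mapping.single a 1)" for a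
  have xcar: "set (map x as) \<subseteq> carrier Q" by (auto simp: x_def Qcar)
  define pol where "pol g = (\<Sum>a\<in>set as. Poly_Mapping.single a (g a))" for g :: "('n \<Rightarrow>\<^sub>0 nat) \<Rightarrow> 'k"
  have comb: "Q.combine (map (\<lambda>a. h (g a)) as) (map x as) = cos (pol g)" for g
    unfolding pol_def using as(2)
    by (induction as) (simp_all add: Qzero h_def x_def Qmult Qadd mult_single)
  have lookup_pol: "Poly_Mapping.lookup (pol g) a = (if a \<in> set as then g a else 0)" for g a
    unfolding pol_def by (simp add: lookup_sum lookup_single when_def)
  have J_iff: "f \<in> J \<longleftrightarrow> (\<forall>a\<in>Poly_Mapping.keys f. \<exists>i. i \<notin> F \<and> Poly_Mapping.lookup a i \<noteq> 0)" for f
    by (auto simp: J_def coord_prime_def mono_span_def)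
  have lists: "\<exists>g. Ks = map (\<lambda>a. h (g a)) as" if Ks: "set Ks \<subseteq> range h" "length Ks = length as" for Ks
  proof -
    obtain g' where g': "Ks = map g' as" using list_eq_map_distinct[OF as(2) Ks(2)] .
    then have "\<forall>a\<in>set as. \<exists>c. g' a = h c" using Ks(1) by auto
    then obtain g where "\<And>a. a \<in> set as \<Longrightarrow> g' a = h (g a)" by metis
    then show ?thesis unfolding g' by (intro exI[of _ g]) simp
  qed
  have "Q.independent (range h) (map x as)"
  proof (rule ccontr)
    assume dep: "Q.dependent (range h) (map x as)"
    then obtain Ks where Ks: "length Ks = length as" "Q.combine Ks (map x as) = \<zero>\<^bsub>Q\<^esub>"
      "set Ks \<subseteq> range h" "set Ks \<noteq> {\<zero>\<^bsub>Q\<^esub>}"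
      using Q.dependent_imp_non_trivial_combine[OF K xcar] by (metis length_map)
    obtain g where g: "Ks = map (\<lambda>a. h (g a)) as" using lists[OF Ks(3,1)] by blast
    have "pol g \<in> J"
      using Ks(2) unfolding g comb Qzero cos_eq by simp
    have "g a = 0" if a: "a \<in> set as" for a
    proof (rule ccontr)
      assume "g a \<noteq> 0"
      then have "a \<in> Poly_Mapping.keys (pol g)"
        using a by (simp add: in_keys_iff lookup_pol)
      then obtain i where "i \<notin> F" "Poly_Mapping.lookup a i \<noteq> 0"
        using \<open>pol g \<in> J\<close> unfolding J_iff by blast
      then show False
        using a as(1) by (simp add: face_monomials_def)
    qed
    then have "set Ks \<subseteq> {\<zero>\<^bsub>Q\<^esub>}" by (auto simp: g h_def Qzero)
    with Ks(4) have "set Ks = {}" by (simp add: subset_singleton_iff)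
    then have "as = []" using g by simp
    then show False using dep by simp
  qed
  moreover have "Q.Span (range h) (map x as) = cos ` hom_part k"
  proof (intro antisym subsetI)
    fix z assume "z \<in> Q.Span (range h) (map x as)"
    then obtain Ks where Ks: "set Ks \<subseteq> range h" "length Ks = length as" "z = Q.combine Ks (map x as)"
      using Q.Span_mem_iff_length_version[OF K xcar] by auto
    obtain g where g: "Ks = map (\<lambda>a. h (g a)) as" using lists[OF Ks(1,2)] by blast
    have "pol g \<in> hom_part k"
      using as(1) lookup_pol[of g] by (auto simp: hom_part_def face_monomials_def in_keys_iff)
    then show "z \<in> cos ` hom_part k" unfolding Ks(3) g comb by blast
  next
    fix z assume "z \<in> cos ` hom_part k"
    then obtain f where f: "f \<in> hom_part k" "z = cos f" by blast
    have "f - pol (Poly_Mapping.lookup f) \<in> J"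
      unfolding J_iff
    proof
      fix a assume a: "a \<in> Poly_Mapping.keys (f - pol (Poly_Mapping.lookup f))"
      then have "a \<notin> face_monomials F k" "a \<in> Poly_Mapping.keys f"
        using as(1) by (auto simp: in_keys_iff lookup_minus lookup_pol split: if_splits)
      then show "\<exists>i. i \<notin> F \<and> Poly_Mapping.lookup a i \<noteq> 0"
        using f(1) by (auto simp: hom_part_def face_monomials_def)
    qed
    then have "z = Q.combine (map (\<lambda>a. h (Poly_Mapping.lookup f a)) as) (map x as)"
      unfolding f(2) comb cos_eq .
    moreover have "set (map (\<lambda>a. h (Poly_Mapping.lookup f a)) as) \<subseteq> range h" by auto
    ultimately show "z \<in> Q.Span (range h) (map x as)"
      unfolding Q.Span_mem_iff_length_version[OF K xcar] by (metis length_map)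
  qed
  ultimately have "Q.dimension (length (map x as)) (range h) (cos ` hom_part k)"
    by (rule Q.dimensionI[OF K])
  then have "Q.dim (range h) (cos ` hom_part k) = length as"
    using Q.dimI[OF K] by (simp add: over_def)
  also have "length as = card (face_monomials F k)"
    using as distinct_card by metis
  finally show ?thesis
    unfolding hilbert_fun_def Q_def J_def h_def[abs_def] cos_def[abs_def] .
qed

text \<open>The binomial coefficient \<open>(e + t) choose e\<close> as a polynomial in \<open>t\<close>: the Hilbert polynomial of a
  polynomial ring in \<open>e + 1\<close> variables.\<close>

definition rising_poly :: "nat \<Rightarrow> real Polynomial.poly" where
  "rising_poly e = Polynomial.smult (1 / fact e) (\<Prod>j\<in>{1..e}. [:real j, 1:])"

lemma degree_rising_poly: "Polynomial.degree (rising_poly e) = e"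
  by (simp add: rising_poly_def degree_prod_eq_sum_degree)

lemma lead_coeff_rising_poly: "Polynomial.lead_coeff (rising_poly e) = 1 / fact e"
proof -
  have "Polynomial.lead_coeff (\<Prod>j\<in>{1..e}. [:real j, 1:]) = 1"
    by (simp only: lead_coeff_prod) simp
  then show ?thesis unfolding rising_poly_def lead_coeff_smult by simp
qed

lemma poly_rising_poly: "Polynomial.poly (rising_poly e) (real k) = real ((e + k) choose k)"
proof -
  have "(\<Prod>j\<in>{1..e}. real j + real k) * fact k = fact (e + k)"
  proof (induction e)
    case (Suc e)
    have "(\<Prod>j\<in>{1..Suc e}. real j + real k) * fact k
        = (real (Suc e) + real k) * ((\<Prod>j\<in>{1..e}. real j + real k) * fact k)"
      by simp
    also have "\<dots> = fact (Suc e + k)"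
      unfolding Suc.IH by simp
    finally show ?case .
  qed simp
  then have "(\<Prod>j\<in>{1..e}. real j + real k) = fact (e + k) / fact k"
    by (simp add: field_simps)
  then show ?thesis
    by (simp add: rising_poly_def poly_prod binomial_fact field_simps)
qed

text \<open>Two polynomials that agree at all large natural numbers are equal, so the definite description
  is determined by any witness.\<close>

lemma hilbert_poly_eqI:
  assumes "\<And>k. N \<le> k \<Longrightarrow> Polynomial.poly P (real k) = real (hilbert_fun J k)"
  shows "hilbert_poly J = P"
  unfolding hilbert_poly_def
proof (rule the_equality)
  show "\<exists>N. \<forall>k\<ge>N. Polynomial.poly P (real k) = real (hilbert_fun J k)" using assms by blast
  fix P' assume "\<exists>N. \<forall>k\<ge>N. Polynomial.poly P' (real k) = real (hilbert_fun J k)"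
  then obtain N' where N': "\<And>k. N' \<le> k \<Longrightarrow> Polynomial.poly P' (real k) = real (hilbert_fun J k)" by blast
  show "P' = P"
  proof (rule ccontr)
    assume "P' \<noteq> P"
    then have "finite {x. Polynomial.poly (P' - P) x = 0}" by (intro poly_roots_finite) simp
    moreover have "real ` {max N N'..} \<subseteq> {x. Polynomial.poly (P' - P) x = 0}"
      using assms N' by auto
    ultimately have "finite (real ` {max N N'..})" by (rule finite_subset[rotated])
    then have "finite {max N N'..}" by (rule finite_imageD) simp
    then show False using infinite_Ici by blast
  qed
qed

text \<open>The quotient by the ideal of all variables is the field \<open>K\<close>: constant terms decide membership.\<close>

lemma mod_length_quot_origin:
  "mod_length mpoly_ring (quot_module mpoly_ring (coord_prime {} :: ('n::finite, 'k::field) mpoly set)) = 1"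
proof -
  define J where "J = (coord_prime {} :: ('n, 'k) mpoly set)"
  have J: "ideal J mpoly_ring" unfolding J_def by (rule coord_prime_ideal)
  define M where "M = quot_module mpoly_ring J"
  interpret module mpoly_ring M unfolding M_def by (rule quot_module_module[OF J mpoly_cring])
  note simps = mpoly_quot_simps[OF J, folded M_def]
  have J_iff: "f \<in> J \<longleftrightarrow> Poly_Mapping.lookup f 0 = 0" for f
  proof -
    have "(\<exists>i. Poly_Mapping.lookup a i \<noteq> 0) \<longleftrightarrow> a \<noteq> 0" for a :: "'n \<Rightarrow>\<^sub>0 nat"
      by (auto simp: poly_mapping_eq_iff fun_eq_iff)
    then show ?thesis by (auto simp: J_def coord_prime_def mono_span_def in_keys_iff)
  qed
  have const_mult: "Poly_Mapping.lookup (Poly_Mapping.single 0 c * f) 0 = c * Poly_Mapping.lookup f 0"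
    for c and f :: "('n, 'k) mpoly"
    unfolding mult_map_scale_conv_mult[symmetric] by (simp add: map.rep_eq when_def)
  have "mod_length mpoly_ring M = enat 1"
  proof (rule mod_length_filtration[where N = "\<lambda>i. if i = 0 then {\<zero>\<^bsub>M\<^esub>} else carrier M"])
    show "abelian_group M" by (rule M.abelian_group_axioms)
    show "submodule (if i = 0 then {\<zero>\<^bsub>M\<^esub>} else carrier M) mpoly_ring M" for i :: nat
    proof (cases "i = 0")
      case True
      have "submodule {\<zero>\<^bsub>M\<^esub>} mpoly_ring M" by (rule submoduleI) auto
      then show ?thesis using True by simp
    qed (simp add: carrier_is_submodule)
    show "(if i = 0 then {\<zero>\<^bsub>M\<^esub>} else carrier M) \<subset> (if Suc i = 0 then {\<zero>\<^bsub>M\<^esub>} else carrier M)"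
      if "i < 1" for i :: nat
    proof -
      have "J +>\<^bsub>mpoly_ring\<^esub> 1 \<in> carrier M - {\<zero>\<^bsub>M\<^esub>}"
        by (simp add: simps mpoly_coset_eq_self_iff[OF J] J_iff)
      then show ?thesis using that M.zero_closed by auto
    qed
  next
    fix i x y assume i: "i < (1::nat)" and "x \<in> (if Suc i = 0 then {\<zero>\<^bsub>M\<^esub>} else carrier M)"
      and "y \<in> (if Suc i = 0 then {\<zero>\<^bsub>M\<^esub>} else carrier M) - (if i = 0 then {\<zero>\<^bsub>M\<^esub>} else carrier M)"
    then obtain f g where f: "x = J +>\<^bsub>mpoly_ring\<^esub> f" and g: "y = J +>\<^bsub>mpoly_ring\<^esub> g" and "y \<noteq> \<zero>\<^bsub>M\<^esub>"
      by (auto simp: simps)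
    then have g0: "Poly_Mapping.lookup g 0 \<noteq> 0"
      by (simp add: simps mpoly_coset_eq_self_iff[OF J] J_iff)
    define r where "r = (Poly_Mapping.single 0 (Poly_Mapping.lookup f 0 / Poly_Mapping.lookup g 0) :: ('n, 'k) mpoly)"
    have "x = r \<odot>\<^bsub>M\<^esub> y"
      unfolding f g simps mpoly_coset_eq_iff[OF J] J_iff lookup_minus r_def const_mult using g0 by simp
    moreover have "r \<odot>\<^bsub>M\<^esub> y \<in> carrier M"
      by (simp add: g simps)
    ultimately have "x = \<zero>\<^bsub>M\<^esub> \<oplus>\<^bsub>M\<^esub> r \<odot>\<^bsub>M\<^esub> y"
      by (simp only: M.l_zero)
    then show "\<exists>r\<in>carrier mpoly_ring. \<exists>z\<in>if i = 0 then {\<zero>\<^bsub>M\<^esub>} else carrier M. x = z \<oplus>\<^bsub>M\<^esub> r \<odot>\<^bsub>M\<^esub> y"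
      using i by (auto simp: mpoly_ring_simps)
  qed simp_all
  then show ?thesis by (simp add: M_def J_def one_enat_def)
qed

text \<open>With \<open>card F = e + 1\<close> the Hilbert polynomial is \<open>rising_poly e\<close>, of degree \<open>e\<close> and leading
  coefficient \<open>1 / e!\<close>.  If \<open>F\<close> is empty, it vanishes and the degree is the length of a field.\<close>

lemma quot_degree_coord_prime: "quot_degree (coord_prime F :: ('n::finite, 'k::field) mpoly set) = 1"
proof (cases "F = {}")
  case True
  have "hilbert_poly (coord_prime F :: ('n, 'k) mpoly set) = 0"
    by (rule hilbert_poly_eqI[of 1]) (simp add: True hilbert_fun_coord_prime card_face_monomials)
  then show ?thesis
    unfolding quot_degree_def Let_def
    by (simp add: True mod_length_quot_origin one_enat_def one_ereal_def)
next
  case False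
  define e where "e = card F - 1"
  have e: "card F = Suc e" using False by (simp add: e_def card_gt_0_iff)
  have P: "hilbert_poly (coord_prime F :: ('n, 'k) mpoly set) = rising_poly e"
    by (rule hilbert_poly_eqI[of 0])
      (simp add: hilbert_fun_coord_prime card_face_monomials e poly_rising_poly)
  have "rising_poly e \<noteq> 0"
    using lead_coeff_rising_poly[of e] by auto
  then show ?thesis
    unfolding quot_degree_def Let_def P lead_coeff_rising_poly degree_rising_poly[of e]
    by (simp add: lead_coeff_rising_poly[unfolded degree_rising_poly] degree_rising_poly one_ereal_def)
qed


section \<open>Associated primes\<close>

lemma ass_primes_mono_quot:
  fixes I :: "('n::finite, 'k::field) mpoly set"
  assumes I: "ideal I mpoly_ring"
  shows "ass_primes mpoly_ring (quot_module mpoly_ring I)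
    = {p. primeideal p mpoly_ring \<and> (\<exists>f. p = {r. r * f \<in> I})}"
  unfolding ass_primes_def
  by (auto simp: mpoly_quot_simps[OF I] mpoly_coset_eq_self_iff[OF I] mpoly_ring_simps)

lemma mpoly_primeidealD:
  fixes p :: "('n::finite, 'k::field) mpoly set"
  assumes "primeideal p mpoly_ring"
  shows "1 \<notin> p" "0 \<in> p" "f \<in> p \<Longrightarrow> g \<in> p \<Longrightarrow> f + g \<in> p" "f \<in> p \<Longrightarrow> g * f \<in> p"
    "f * g \<in> p \<Longrightarrow> f \<in> p \<or> g \<in> p"
proof -
  interpret primeideal p mpoly_ring by fact
  show "1 \<notin> p"
  proof
    assume "1 \<in> p"
    then show False using one_imp_carrier I_notcarr by (simp add: mpoly_ring_simps)
  qed
  show "0 \<in> p"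
    using additive_subgroup.zero_closed[OF ideal.axioms(1)[OF is_ideal]] by (simp add: mpoly_ring_simps)
  show "f \<in> p \<Longrightarrow> g \<in> p \<Longrightarrow> f + g \<in> p" using additive_subgroup.a_closed[OF ideal.axioms(1)[OF is_ideal], of f g] by (simp add: mpoly_ring_simps)
  show "f \<in> p \<Longrightarrow> g * f \<in> p" using I_l_closed[of f g] by (simp add: mpoly_ring_simps)
  show "f * g \<in> p \<Longrightarrow> f \<in> p \<or> g \<in> p" using I_prime[of f g] by (simp add: mpoly_ring_simps)
qed

lemma mpoly_primeideal_prod:
  fixes p :: "('n::finite, 'k::field) mpoly set"
  assumes "primeideal p mpoly_ring" "finite A" "\<And>m. m \<in> A \<Longrightarrow> r m \<notin> p"
  shows "(\<Prod>m\<in>A. r m) \<notin> p"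
  using assms(2,3)
  by (induction A rule: finite_induct) (auto simp: mpoly_primeidealD(1)[OF assms(1)] dest: mpoly_primeidealD(5)[OF assms(1)])

text \<open>A prime containing a power of a variable contains the variable, and the variables outside \<open>F\<close>
  generate the coordinate prime.\<close>

lemma coord_prime_subset:
  fixes p :: "('n::finite, 'k::field) mpoly set"
  assumes p: "primeideal p mpoly_ring"
    and var: "\<And>i. i \<notin> F \<Longrightarrow> \<exists>k::nat. Poly_Mapping.single (Poly_Mapping.single i k) 1 \<in> p"
  shows "coord_prime F \<subseteq> p"
proof
  fix r :: "('n, 'k) mpoly" assume r: "r \<in> coord_prime F"
  have x: "Poly_Mapping.single (Poly_Mapping.single i 1) 1 \<in> p" if iF: "i \<notin> F" for i
  proof -
    obtain k :: nat where "Poly_Mapping.single (Poly_Mapping.single i k) 1 \<in> p"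
      using var[OF iF] by blast
    then show ?thesis
    proof (induction k)
      case 0
      then show ?case using mpoly_primeidealD(1)[OF p] by simp
    next
      case (Suc k)
      have "(Poly_Mapping.single (Poly_Mapping.single i (Suc k)) 1 :: ('n, 'k) mpoly)
          = Poly_Mapping.single (Poly_Mapping.single i k) 1 * Poly_Mapping.single (Poly_Mapping.single i 1) 1"
        by (simp add: mult_single single_add[symmetric])
      then show ?case using Suc mpoly_primeidealD(5)[OF p] by metis
    qed
  qed
  have sing: "Poly_Mapping.single a c \<in> p" if a: "a \<in> Poly_Mapping.keys r" for a c
  proof -
    obtain i where i: "i \<notin> F" "Poly_Mapping.lookup a i \<noteq> 0"
      using r a by (auto simp: coord_prime_def mono_span_def)
    have "a = (a - Poly_Mapping.single i 1) + Poly_Mapping.single i 1"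
      by (rule poly_mapping_eqI) (use i(2) in \<open>auto simp: lookup_add lookup_minus lookup_single when_def\<close>)
    then have "Poly_Mapping.single a c
        = Poly_Mapping.single (a - Poly_Mapping.single i 1) c * Poly_Mapping.single (Poly_Mapping.single i 1) 1"
      by (simp add: mult_single)
    then show ?thesis using x[OF i(1)] mpoly_primeidealD(4)[OF p] by simp
  qed
  have "(\<Sum>a\<in>A. Poly_Mapping.single a (Poly_Mapping.lookup r a)) \<in> p"
    if "finite A" "A \<subseteq> Poly_Mapping.keys r" for A
    using that
    by (induction A rule: finite_induct) (simp_all add: sing mpoly_primeidealD(2,3)[OF p])
  moreover have "r = (\<Sum>a\<in>Poly_Mapping.keys r. Poly_Mapping.single a (Poly_Mapping.lookup r a))"
    by (rule poly_mapping_eqI) (auto simp: lookup_sum lookup_single when_def in_keys_iff)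
  ultimately show "r \<in> p" by (metis order_refl finite_keys)
qed

text \<open>The witness is the monomial with exponent \<open>m\<close>, with \<open>\<infinity>\<close> replaced by a large \<open>N\<close>.  Multiplication by
  variables in \<open>F\<close> keeps it below \<open>m\<close>, hence nonzero; for \<open>i \<notin> F\<close> raising the coordinate \<open>i\<close> of \<open>m\<close> leaves \<open>\<Gamma>\<close> by
  maximality, and this is already visible at a finite \<open>N\<close>.\<close>

lemma infpt_max_coord_prime_associated:
  fixes \<Gamma> :: "('n::finite \<Rightarrow> enat) set"
  assumes mc: "multicomplex \<Gamma>" and m: "m \<in> max_elems \<Gamma>"
  obtains f :: "('n, 'k::field) mpoly" where "coord_prime (infpt m) = {r. r * f \<in> mc_ideal \<Gamma>}"
proof -
  define F where "F = infpt m"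
  obtain b where b: "m = infty_on F b" using infty_on_cases[of m] unfolding F_def .
  have "\<exists>N0. \<forall>N\<ge>N0. infty_on {} (block F N + (Poly_Mapping.single i 1 + b)) \<notin> \<Gamma>" if "i \<notin> F" for i
  proof -
    have "m \<le> infty_on F (Poly_Mapping.single i 1 + b)"
      unfolding b by (simp add: infty_on_le_iff lookup_add)
    moreover have "infty_on F (Poly_Mapping.single i 1 + b) \<noteq> m"
      unfolding b infty_on_eq_iff using that by (auto simp: lookup_add intro!: exI[of _ i])
    ultimately have "infty_on F (Poly_Mapping.single i 1 + b) \<notin> \<Gamma>"
      using max_elems_maximal[OF m] by blast
    then show ?thesis using infty_on_limit[OF mc] by metis
  qed
  then obtain N0 where N0: "\<And>i N. i \<notin> F \<Longrightarrow> N0 i \<le> N \<Longrightarrow>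
      infty_on {} (block F N + (Poly_Mapping.single i 1 + b)) \<notin> \<Gamma>"
    by metis
  define N where "N = (\<Sum>i\<in>-F. N0 i)"
  define w where "w = block F N + b"
  have key: "infty_on {} (w + a) \<notin> \<Gamma> \<longleftrightarrow> (\<exists>i. i \<notin> F \<and> Poly_Mapping.lookup a i \<noteq> 0)" for a
  proof
    assume "infty_on {} (w + a) \<notin> \<Gamma>"
    then have "\<not> infty_on {} (w + a) \<le> m"
      using multicomplex_mem_iff[OF mc] m by blast
    then have "\<not> infty_on F (w + a) \<le> m"
      using infty_on_le_iff_of_infpt[of m F "w + a"] by (simp add: F_def)
    then show "\<exists>i. i \<notin> F \<and> Poly_Mapping.lookup a i \<noteq> 0"
      unfolding b infty_on_le_iff by (auto simp: w_def lookup_add lookup_block)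
  next
    assume "\<exists>i. i \<notin> F \<and> Poly_Mapping.lookup a i \<noteq> 0"
    then obtain i where i: "i \<notin> F" "Poly_Mapping.lookup a i \<noteq> 0" by blast
    have "N0 i \<le> N" unfolding N_def using i(1) by (intro member_le_sum) auto
    then have "infty_on {} (block F N + (Poly_Mapping.single i 1 + b)) \<notin> \<Gamma>" by (rule N0[OF i(1)])
    moreover have "infty_on {} (block F N + (Poly_Mapping.single i 1 + b)) \<le> infty_on {} (w + a)"
      unfolding infty_on_le_iff w_def
      using i(2) by (auto simp: lookup_add lookup_single when_def)
    ultimately show "infty_on {} (w + a) \<notin> \<Gamma>"
      using multicomplex_downward[OF mc] by blast
  qed
  have "r * Poly_Mapping.single w 1 \<in> mc_ideal \<Gamma> \<longleftrightarrow> r \<in> coord_prime F" for r :: "('n, 'k) mpoly"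
    unfolding mult.commute[of r] mc_ideal_eq_infty_on single_mult_mem_mono_span
    by (simp add: key coord_prime_def mono_span_def subset_eq)
  then show thesis using that unfolding F_def by blast
qed

text \<open>If \<open>p\<close> is the annihilator of \<open>f\<close>, then it is the intersection of the finitely many ideals
  \<open>(I\<^sub>m : f)\<close> with \<open>I\<^sub>m\<close> the irreducible component of \<open>I\<close> at the maximal element \<open>m\<close>.  A prime equal to a finite
  intersection equals one of its members, and \<open>(I\<^sub>m : f)\<close> can only be prime if it is the radical of the
  primary ideal \<open>I\<^sub>m\<close>.\<close>

lemma ass_primes_mc_ideal:
  fixes \<Gamma> :: "('n::finite \<Rightarrow> enat) set"
  assumes mc: "multicomplex \<Gamma>"
  shows "ass_primes mpoly_ring (quot_module mpoly_ring (mc_ideal \<Gamma> :: ('n, 'k::field) mpoly set))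
    = coord_prime ` infpt ` max_elems \<Gamma>"
  unfolding ass_primes_mono_quot[OF mc_ideal_ideal[OF mc]]
proof (intro antisym subsetI)
  fix p :: "('n, 'k) mpoly set" assume "p \<in> coord_prime ` infpt ` max_elems \<Gamma>"
  then obtain m where m: "m \<in> max_elems \<Gamma>" "p = coord_prime (infpt m)" by blast
  obtain f :: "('n, 'k) mpoly" where "coord_prime (infpt m) = {r. r * f \<in> mc_ideal \<Gamma>}"
    by (rule infpt_max_coord_prime_associated[OF mc m(1)])
  then show "p \<in> {p. primeideal p mpoly_ring \<and> (\<exists>f. p = {r. r * f \<in> mc_ideal \<Gamma>})}"
    using m(2) coord_prime_prime by blast
next
  fix p :: "('n, 'k) mpoly set"
  assume "p \<in> {p. primeideal p mpoly_ring \<and> (\<exists>f. p = {r. r * f \<in> mc_ideal \<Gamma>})}"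
  then obtain f where p: "primeideal p mpoly_ring" and pf: "p = {r. r * f \<in> mc_ideal \<Gamma>}" by blast
  define D where "D m = {a. \<not> infty_on {} a \<le> m}" for m :: "'n \<Rightarrow> enat"
  have "infty_on {} a \<notin> \<Gamma> \<longleftrightarrow> (\<forall>m\<in>max_elems \<Gamma>. a \<in> D m)" for a
    unfolding D_def multicomplex_mem_iff[OF mc] by blast
  then have inter: "g \<in> mc_ideal \<Gamma> \<longleftrightarrow> (\<forall>m\<in>max_elems \<Gamma>. g \<in> mono_span (D m))" for g :: "('n, 'k) mpoly"
    unfolding mc_ideal_eq_infty_on mono_span_def by blast
  have stable: "stable_outside (infpt m) (D m)" for m
    unfolding stable_outside_def D_def
  proof (intro ballI allI impI, clarsimp)
    fix a b assume ab: "\<forall>i. i \<notin> infpt m \<longrightarrow> Poly_Mapping.lookup a i \<le> Poly_Mapping.lookup b i"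
      and a: "\<not> infty_on {} a \<le> m" and "infty_on {} b \<le> m"
    then have "infty_on (infpt m) b \<le> m" using infty_on_le_iff_of_infpt by blast
    moreover have "infty_on (infpt m) a \<le> infty_on (infpt m) b" using ab by (simp add: infty_on_le_iff)
    ultimately have "infty_on (infpt m) a \<le> m" by (rule order_trans[rotated])
    then show False using a infty_on_le_iff_of_infpt by blast
  qed
  have "\<exists>m\<in>max_elems \<Gamma>. \<forall>r. r * f \<in> mono_span (D m) \<longrightarrow> r \<in> p"
  proof (rule ccontr)
    assume "\<not> ?thesis"
    \<comment> \<open>The product of the \<open>r m\<close> would annihilate \<open>f\<close> modulo every component.\<close>
    then obtain r where r: "\<And>m. m \<in> max_elems \<Gamma> \<Longrightarrow> r m * f \<in> mono_span (D m)"
      "\<And>m. m \<in> max_elems \<Gamma> \<Longrightarrow> r m \<notin> p" by metis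
    have "(\<Prod>m\<in>max_elems \<Gamma>. r m) * f \<in> mono_span (D m)" if m: "m \<in> max_elems \<Gamma>" for m
    proof -
      have "(\<Prod>m\<in>max_elems \<Gamma>. r m) * f = (\<Prod>m\<in>max_elems \<Gamma> - {m}. r m) * (r m * f)"
        using prod.remove[OF finite_max_elems m, of r] by (simp add: mult_ac)
      also have "\<dots> \<in> mono_span (D m)"
        by (rule mono_span_mult[OF stable_outside_add[OF stable] r(1)[OF m]])
      finally show ?thesis .
    qed
    then have "(\<Prod>m\<in>max_elems \<Gamma>. r m) \<in> p" unfolding pf inter by blast
    moreover have "(\<Prod>m\<in>max_elems \<Gamma>. r m) \<notin> p"
      by (rule mpoly_primeideal_prod[OF p finite_max_elems r(2)])
    ultimately show False by blast
  qed
  then obtain m where m: "m \<in> max_elems \<Gamma>" "\<And>r. r * f \<in> mono_span (D m) \<Longrightarrow> r \<in> p" by blast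
  have f: "f \<notin> mono_span (D m)"
    using m(2)[of 1] mpoly_primeidealD(1)[OF p] by auto
  have "p \<subseteq> coord_prime (infpt m)"
  proof
    fix r assume "r \<in> p"
    then have "r * f \<in> mono_span (D m)" unfolding pf inter using m(1) by blast
    then show "r \<in> coord_prime (infpt m)"
      using mono_span_cancel[OF stable] f by blast
  qed
  moreover have "coord_prime (infpt m) \<subseteq> p"
  proof (rule coord_prime_subset[OF p])
    fix i assume "i \<notin> infpt m"
    then obtain k where k: "m i = enat k" by (auto simp: infpt_def)
    \<comment> \<open>The power \<open>k + 1\<close> of \<open>x\<^sub>i\<close> already lies in the component of \<open>m\<close>, where \<open>k = m i\<close>.\<close>
    have "Poly_Mapping.single i (Suc k) + b \<in> D m" for b
    proof -
      have "\<not> infty_on {} (Poly_Mapping.single i (Suc k) + b) i \<le> m i"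
        by (simp add: k infty_on_def lookup_add)
      then show ?thesis unfolding D_def le_fun_def by blast
    qed
    then have "Poly_Mapping.single (Poly_Mapping.single i (Suc k)) 1 * f \<in> mono_span (D m)"
      by (simp add: single_mult_mem_mono_span)
    then show "\<exists>k::nat. Poly_Mapping.single (Poly_Mapping.single i k) 1 \<in> p" using m(2) by blast
  qed
  ultimately show "p \<in> coord_prime ` infpt ` max_elems \<Gamma>" using m(1) by blast
qed


section \<open>The arithmetic degree\<close>

theorem proposition3p1:
  fixes \<Gamma> :: "('n::finite \<Rightarrow> enat) set"
  assumes "multicomplex \<Gamma>"
  shows "finite (facets \<Gamma>) \<and>
    arith_degree (quot_module mpoly_ring (mc_ideal \<Gamma> :: ('n, 'k::field) mpoly set))
      = ereal (real (card (facets \<Gamma>)))"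
proof
  show fin: "finite (facets \<Gamma>)" by (rule finite_facets[OF assms])
  let ?M = "quot_module mpoly_ring (mc_ideal \<Gamma> :: ('n, 'k) mpoly set)"
  have ass: "ass_primes mpoly_ring ?M = coord_prime ` infpt ` facets \<Gamma>"
    unfolding infpt_facets[OF assms] by (rule ass_primes_mc_ideal[OF assms])
  have inj: "inj_on (coord_prime :: 'n set \<Rightarrow> ('n, 'k) mpoly set) (infpt ` facets \<Gamma>)"
    by (rule inj_onI) (rule coord_prime_inj)
  have "arith_degree ?M = (\<Sum>F\<in>infpt ` facets \<Gamma>.
      ereal_of_enat (local_mult mpoly_ring ?M (coord_prime F)) * quot_degree (coord_prime F :: ('n, 'k) mpoly set))"
    unfolding arith_degree_def ass sum.reindex[OF inj] by (simp add: o_def)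
  also have "\<dots> = (\<Sum>F\<in>infpt ` facets \<Gamma>. ereal (real (card (facets_at \<Gamma> F))))"
    by (simp add: local_mult_eq_card_facets[OF assms] quot_degree_coord_prime)
  also have "\<dots> = ereal (real (\<Sum>F\<in>infpt ` facets \<Gamma>. card (facets_at \<Gamma> F)))"
    by simp
  also have "(\<Sum>F\<in>infpt ` facets \<Gamma>. card (facets_at \<Gamma> F)) = card (facets \<Gamma>)"
    using sum.image_gen[OF fin, of "\<lambda>_. 1::nat" infpt] by (simp add: facets_at_def)
  finally show "arith_degree ?M = ereal (real (card (facets \<Gamma>)))" .
qed

end
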